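(* Let $K$ be a field, let $d\le n$ be positive integers, let $\mathcal{C}\neq\mathcal{C}_{n,d}$ be a $d$-uniform clutter on $[n]$, and let $I=I(\bar{\mathcal{C}})\subset S=K[x_1,\dots,x_n]$ be its circuit ideal. Let $e$ be a submaximal circuit of $\mathcal{C}$, and suppose that $F\in\mathcal{C}$ is the only circuit of $\mathcal{C}$ containing $e$. Then $\operatorname{reg}(I)=\operatorname{reg}(I+(\mathbf{x}_F))$.
   Context: $[n]=\{1,\dots,n\}$. A $d$-uniform clutter $\mathcal{C}$ on $[n]$ is a set of $d$-element subsets of $[n]$ (called circuits). $\mathcal{C}_{n,d}$ denotes the set of all $d$-subsets of $[n]$, and the complement of $\mathcal{C}$ is $\bar{\mathcal{C}}=\mathcal{C}_{n,d}\setminus\mathcal{C}$. For a clutter $\mathcal{D}$ on $[n]$, $I(\mathcal{D})=(\mathbf{x}_F : F\in\mathcal{D})\subset S$, where $\mathbf{x}_F=\prod_{i\in F}x_i$, and $I(\varnothing)=0$. A $(d-1)$-subset $e\subset[n]$ is a submaximal circuit of $\mathcal{C}$ if $e\subset F$ for some $F\in\mathcal{C}$. For a nonzero homogeneous ideal $I\subset S$, $\operatorname{reg}(I)=\sup\{j-i : \beta^S_{i,j}(I)\neq0\}$ is the Castelnuovo-Mumford regularity, where $\beta^S_{i,j}(I)$ are the graded Betti numbers of $I$ as an $S$-module. *)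

theory Defs
  imports
    Complex_Main
    "HOL-Library.Cardinality"
    "HOL-Library.Poly_Mapping"
    "HOL-Library.Set_Algebras"
    "HOL-Library.Extended_Real"
begin

section \<open>Polynomial rings in finitely many variables\<close>

text \<open>
  The vertex set \<open>[n]\<close> is a finite type \<open>'n\<close>, so \<open>n = CARD('n)\<close>, and the polynomial ring
  \<open>S = K[x\<^sub>1, \<dots>, x\<^sub>n]\<close> is a whole type: finitely supported functions from exponent vectors
  to the coefficient field.
\<close>

type_synonym ('n, 'k) mpolynomial = "('n \<Rightarrow>\<^sub>0 nat) \<Rightarrow>\<^sub>0 'k"

definition indet :: "'n \<Rightarrow> ('n, 'k::comm_ring_1) mpolynomial" where
  "indet i = Poly_Mapping.single (Poly_Mapping.single i 1) 1"

definition exponent_degree :: "('n::finite \<Rightarrow>\<^sub>0 nat) \<Rightarrow> nat" where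
  "exponent_degree m = (\<Sum>i\<in>UNIV. Poly_Mapping.lookup m i)"

text \<open>
  In particular, the zero polynomial is homogeneous of every degree.
\<close>

definition homogeneous_of_degree :: "nat \<Rightarrow> ('n::finite, 'k::zero) mpolynomial \<Rightarrow> bool" where
  "homogeneous_of_degree j p \<longleftrightarrow> (\<forall>m\<in>Poly_Mapping.keys p. exponent_degree m = j)"

text \<open>The ideal of a commutative ring generated by \<open>B\<close>; it is \<open>{0}\<close> for \<open>B = {}\<close>.\<close>

definition ideal_generated_by :: "'a::comm_ring_1 set \<Rightarrow> 'a set" where
  "ideal_generated_by B = module.span (*) B"

lemma module_times: "module ((*) :: 'a::comm_ring_1 \<Rightarrow> 'a \<Rightarrow> 'a)"
  by unfold_locales (simp_all add: algebra_simps)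

definition graded_maximal_ideal :: "('n, 'k::comm_ring_1) mpolynomial set" where
  "graded_maximal_ideal = ideal_generated_by (indet ` UNIV)"


section \<open>Minimal graded free resolutions\<close>

text \<open>
  Elements of the free module \<open>S\<^sup>r\<close> are functions on \<open>nat\<close> vanishing from index \<open>r\<close> on.
\<close>

definition free_module :: "nat \<Rightarrow> (nat \<Rightarrow> 'a::zero) set" where
  "free_module r = {v. \<forall>t\<ge>r. v t = 0}"

definition matrix_map :: "nat \<Rightarrow> nat \<Rightarrow> (nat \<Rightarrow> nat \<Rightarrow> 'a::comm_ring_1) \<Rightarrow> (nat \<Rightarrow> 'a) \<Rightarrow> (nat \<Rightarrow> 'a)" where
  "matrix_map r c A v = (\<lambda>s. if s < r then (\<Sum>t<c. A s t * v t) else 0)"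

text \<open>
  A minimal graded free resolution
  \<open>\<dots> \<rightarrow> F\<^sub>2 \<rightarrow> F\<^sub>1 \<rightarrow> F\<^sub>0 \<rightarrow> I \<rightarrow> 0\<close> of an ideal \<open>I\<close>, where
  \<open>F\<^sub>i = \<Oplus>\<^bsub>t < r i\<^esub> S(- a i t)\<close>. The augmentation sends the \<open>t\<close>-th basis element of
  \<open>F\<^sub>0\<close> to \<open>\<epsilon> t\<close>, and \<open>A i\<close> is the matrix of the differential \<open>F\<^sub>i\<^sub>+\<^sub>1 \<rightarrow> F\<^sub>i\<close>. The maps are
  homogeneous of degree 0; in terms of entries, \<open>\<epsilon> t\<close> has degree \<open>a 0 t\<close> and
  \<open>A i s t\<close> has degree \<open>a (i + 1) t - a i s\<close> (so it is zero when this number is negative).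
  Minimality says that \<open>F\<^sub>i\<^sub>+\<^sub>1\<close> is mapped into \<open>\<mm> F\<^sub>i\<close>.
  Shifts in \<open>nat\<close> are enough, since the generators and syzygies of an ideal of \<open>S\<close>
  occurring in such a resolution live in nonnegative degrees.
\<close>

definition minimal_graded_free_resolution ::
  "('n::finite, 'k::field) mpolynomial set \<Rightarrow> (nat \<Rightarrow> nat) \<Rightarrow> (nat \<Rightarrow> nat \<Rightarrow> nat) \<Rightarrow>
   (nat \<Rightarrow> ('n, 'k) mpolynomial) \<Rightarrow> (nat \<Rightarrow> nat \<Rightarrow> nat \<Rightarrow> ('n, 'k) mpolynomial) \<Rightarrow> bool" where
  "minimal_graded_free_resolution I r a \<epsilon> A \<longleftrightarrow>
     (\<forall>t < r 0. homogeneous_of_degree (a 0 t) (\<epsilon> t)) \<and>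
     (\<forall>i. \<forall>s < r i. \<forall>t < r (Suc i).
        \<forall>m\<in>Poly_Mapping.keys (A i s t). exponent_degree m + a i s = a (Suc i) t) \<and>
     (\<lambda>v. \<Sum>t < r 0. v t * \<epsilon> t) ` free_module (r 0) = I \<and>
     {v \<in> free_module (r 0). (\<Sum>t < r 0. v t * \<epsilon> t) = 0}
       = matrix_map (r 0) (r 1) (A 0) ` free_module (r 1) \<and>
     (\<forall>i. {v \<in> free_module (r (Suc i)). matrix_map (r i) (r (Suc i)) (A i) v = (\<lambda>_. 0)}
       = matrix_map (r (Suc i)) (r (Suc (Suc i))) (A (Suc i)) ` free_module (r (Suc (Suc i)))) \<and>
     (\<forall>i. \<forall>s < r i. \<forall>t < r (Suc i). A i s t \<in> graded_maximal_ideal)"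

text \<open>
  \<open>\<beta>\<^bsub>i,j\<^esub>(I)\<close> is the number of summands \<open>S(-j)\<close> of \<open>F\<^sub>i\<close>; for a homogeneous ideal \<open>I\<close> a minimal
  graded free resolution exists, and this number does not depend on its choice.
\<close>

definition graded_betti :: "('n::finite, 'k::field) mpolynomial set \<Rightarrow> nat \<Rightarrow> nat \<Rightarrow> nat" where
  "graded_betti I i j =
     (THE b. \<exists>r a \<epsilon> A. minimal_graded_free_resolution I r a \<epsilon> A \<and> b = card {t. t < r i \<and> a i t = j})"

text \<open>
  The supremum is taken in \<open>ereal\<close>, so that it makes sense without knowing beforehand that the set
  is bounded.
\<close>

definition cm_regularity :: "('n::finite, 'k::field) mpolynomial set \<Rightarrow> ereal" where
  "cm_regularity I = Sup {ereal (real j - real i) | i j. graded_betti I i j \<noteq> 0}"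


section \<open>Clutters and circuit ideals\<close>

definition full_clutter :: "nat \<Rightarrow> 'n::finite set set" where
  "full_clutter d = {F. card F = d}"

definition uniform_clutter :: "nat \<Rightarrow> 'n::finite set set \<Rightarrow> bool" where
  "uniform_clutter d \<C> \<longleftrightarrow> \<C> \<subseteq> full_clutter d"

definition clutter_complement :: "nat \<Rightarrow> 'n::finite set set \<Rightarrow> 'n set set" where
  "clutter_complement d \<C> = full_clutter d - \<C>"

definition set_monomial :: "'n set \<Rightarrow> ('n, 'k::comm_ring_1) mpolynomial" where
  "set_monomial F = (\<Prod>i\<in>F. indet i)"

definition circuit_ideal :: "'n set set \<Rightarrow> ('n, 'k::comm_ring_1) mpolynomial set" where
  "circuit_ideal \<D> = ideal_generated_by (set_monomial ` \<D>)"

definition submaximal_circuit :: "nat \<Rightarrow> 'n::finite set set \<Rightarrow> 'n set \<Rightarrow> bool" where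
  "submaximal_circuit d \<C> e \<longleftrightarrow> card e = d - 1 \<and> (\<exists>F\<in>\<C>. e \<subset> F)"

end

theory Submission
  imports
    Defs
    "HOL-Library.Function_Algebras"
begin

text \<open>
  Write \<open>P\<close> for the ideal generated by the variables outside \<open>F\<close> and \<open>J = I + (x\<^sub>F)\<close>. Every generator of
  \<open>I\<close> is a \<open>d\<close>-set different from \<open>F\<close>, hence not contained in \<open>F\<close>, so \<open>I : x\<^sub>F \<subseteq> P\<close>. The free submaximal
  circuit gives more than the converse inclusion: for \<open>v \<notin> F\<close> the \<open>d\<close>-set \<open>e \<union> {v}\<close> is not in \<open>\<C>\<close>, so already
  \<open>x\<^sub>e P \<subseteq> I\<close>. Thus \<open>J/I\<close> is a shifted copy of \<open>S/P\<close>, which has a linear resolution, and \<open>J\<close> is resolved by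
  the mapping cone of a chain map from the resolution of \<open>S/P\<close> to that of \<open>S/I\<close> which lifts multiplication
  by \<open>x\<^sub>F\<close>. Write \<open>F = e \<union> {x}\<close>. Since multiplication by \<open>x\<^sub>e\<close> alone maps \<open>P\<close> into \<open>I\<close>, the chain map can be
  chosen to be the variable \<open>x\<close> times a chain map lifting \<open>x\<^sub>e\<close>. All its entries then lie in the maximal
  ideal, so the cone is a minimal resolution. Consequently the Betti numbers of \<open>J\<close> are those of \<open>I\<close> plus
  contributions in the degrees \<open>j = i + d\<close>. As \<open>I\<close> is nonzero and generated in degree \<open>d\<close>, the value
  \<open>j - i = d\<close> is already attained by \<open>I\<close>, and the two suprema agree. The cone is
  \<open>mapping_cone_resolution\<close>; applied to \<open>g = x\<^sub>v\<close> and \<open>I = P\<close> it also builds the linear resolutions of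
  ideals of variables, one variable at a time (\<open>variable_ideal_linear_resolution\<close>).

  Two general facts make Betti numbers computable from any one resolution. Uniqueness
  (\<open>graded_betti_eq_card\<close>): comparison maps in both directions between two minimal resolutions compose to a
  map homotopic to the identity, and since the differentials have no constant terms, the constant terms of
  the composite form an identity matrix; as comparison maps can be chosen homogeneous, the resulting inequality
  of ranks holds in every degree separately. Existence (\<open>squarefree_ideal_has_resolution\<close>): the syzygies
  that occur for squarefree monomial ideals are again generated in squarefree multidegrees. There are only
  finitely many of these, and the syzygies of each such multidegree form a finite-dimensional vector space, so bases
  of these spaces are a finite generating set, which can be thinned out to an irredundant one.
\<close>

section \<open>Coefficients and exponents\<close>

abbreviation lookup where "lookup \<equiv> Poly_Mapping.lookup"
abbreviation keys where "keys \<equiv> Poly_Mapping.keys"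
abbreviation monom where "monom \<equiv> Poly_Mapping.single"

lemma sum_monom_keys: "(\<Sum>m\<in>keys p. monom m (lookup p m)) = p"
  by (rule poly_mapping_eqI)
     (auto simp: lookup_sum lookup_single when_def not_in_keys_iff_lookup_eq_zero)

lemma lookup_monom_mult_add:
  fixes m k :: "'n \<Rightarrow>\<^sub>0 nat" and p :: "('n, 'k::comm_ring_1) mpolynomial"
  shows "lookup (monom m c * p) (m + k) = c * lookup p k"
  by (simp add: lookup_mult lookup_single when_mult)

lemma lookup_monom_mult_eq_0:
  fixes m k :: "'n \<Rightarrow>\<^sub>0 nat" and p :: "('n, 'k::comm_ring_1) mpolynomial"
  assumes "\<And>l. k \<noteq> m + l"
  shows "lookup (monom m c * p) k = 0"
  using keys_mult[of "monom m c" p] assms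
  by (auto simp: subset_eq not_in_keys_iff_lookup_eq_zero[symmetric] split: if_splits)

text \<open>
  Reduces coefficients of products to those of products with a single monomial, which are governed by the
  two preceding lemmas.
\<close>

lemma lookup_mult_keys:
  fixes p q :: "('n, 'k::comm_ring_1) mpolynomial"
  shows "lookup (p * q) k = (\<Sum>m\<in>keys p. lookup (monom m (lookup p m) * q) k)"
proof -
  have "p * q = (\<Sum>m\<in>keys p. monom m (lookup p m) * q)"
    by (simp add: sum_monom_keys flip: sum_distrib_right)
  then show ?thesis by (simp add: lookup_sum)
qed

lemma lookup_add_eq_0_iff: "l + m = (0 :: 'n \<Rightarrow>\<^sub>0 nat) \<longleftrightarrow> l = 0 \<and> m = 0"
  by (auto simp: poly_mapping_eq_iff fun_eq_iff lookup_add)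

lemma const_coeff_mult:
  fixes p q :: "('n, 'k::comm_ring_1) mpolynomial"
  shows "lookup (p * q) 0 = lookup p 0 * lookup q 0"
proof -
  have "lookup (monom m c * q) 0 = (if m = 0 then c * lookup q 0 else 0)" for m :: "'n \<Rightarrow>\<^sub>0 nat" and c
  proof (cases "m = 0")
    case True
    then show ?thesis using lookup_monom_mult_add[of 0 c q 0] by simp
  next
    case False
    then have "0 \<noteq> m + l" for l
      using lookup_add_eq_0_iff[of m l] by (metis (no_types))
    then have "lookup (monom m c * q) 0 = 0"
      by (rule lookup_monom_mult_eq_0)
    with False show ?thesis by simp
  qed
  then show ?thesis
    by (simp add: lookup_mult_keys[of p q] not_in_keys_iff_lookup_eq_zero)
qed

lemma const_coeff_sum_mult:
  fixes p q :: "'i \<Rightarrow> ('n, 'k::comm_ring_1) mpolynomial"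
  shows "lookup (\<Sum>k\<in>X. p k * q k) 0 = (\<Sum>k\<in>X. lookup (p k) 0 * lookup (q k) 0)"
  by (simp add: lookup_sum const_coeff_mult)

lemma keys_uminus_poly: "keys (- p) = keys (p :: ('n, 'k::comm_ring_1) mpolynomial)"
  by (auto simp: in_keys_iff)

lemma exponent_diff_add:
  fixes k m :: "'n \<Rightarrow>\<^sub>0 nat"
  assumes "\<And>i. lookup m i \<le> lookup k i"
  shows "m + (k - m) = k"
  using assms by (auto intro!: poly_mapping_eqI simp: lookup_add lookup_minus)

lemma exponent_degree_add: "exponent_degree (l + m) = exponent_degree l + exponent_degree m"
  by (simp add: exponent_degree_def lookup_add sum.distrib)

lemma exponent_degree_0 [simp]: "exponent_degree 0 = 0"
  by (simp add: exponent_degree_def)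

text \<open>
  For a predicate fixing the degree, this is the homogeneous component of that degree.
\<close>

definition part_where :: "(('n \<Rightarrow>\<^sub>0 nat) \<Rightarrow> bool) \<Rightarrow> ('n, 'k::comm_ring_1) mpolynomial \<Rightarrow> ('n, 'k) mpolynomial" where
  "part_where P p = (\<Sum>m\<in>{m\<in>keys p. P m}. monom m (lookup p m))"

lemma lookup_part_where: "lookup (part_where P p) m = (if P m then lookup p m else 0)"
  by (auto simp: part_where_def lookup_sum lookup_single when_def not_in_keys_iff_lookup_eq_zero)

lemma keys_part_where: "keys (part_where P p) = {m \<in> keys p. P m}"
  by (auto simp: in_keys_iff lookup_part_where split: if_splits)

lemma part_where_sum: "part_where P (\<Sum>k\<in>X. p k) = (\<Sum>k\<in>X. part_where P (p k))"
  by (rule poly_mapping_eqI) (simp add: lookup_part_where lookup_sum)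

lemma part_where_eq_self: "(\<And>m. m \<in> keys p \<Longrightarrow> P m) \<Longrightarrow> part_where P p = p"
  by (rule poly_mapping_eqI) (auto simp: lookup_part_where in_keys_iff)

lemma part_where_mult:
  assumes "\<And>l m. l \<in> keys p \<Longrightarrow> P (l + m) \<longleftrightarrow> Q m"
  shows "part_where P (p * q) = p * part_where Q q"
proof (rule poly_mapping_eqI)
  fix k
  have "lookup (monom l (lookup p l) * part_where Q q) k =
        (if P k then lookup (monom l (lookup p l) * q) k else 0)" if l: "l \<in> keys p" for l
  proof (cases "\<exists>m. k = l + m")
    case True
    then show ?thesis using assms[OF l] by (auto simp: lookup_monom_mult_add lookup_part_where)
  next
    case False
    then show ?thesis by (simp add: lookup_monom_mult_eq_0)
  qed
  then show "lookup (part_where P (p * q)) k = lookup (p * part_where Q q) k"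
    by (simp add: lookup_part_where lookup_mult_keys[of p q] lookup_mult_keys[of p "part_where Q q"])
qed

definition indicator_exponent :: "'n::finite set \<Rightarrow> 'n \<Rightarrow>\<^sub>0 nat" where
  "indicator_exponent V = (\<Sum>i\<in>V. monom i 1)"

lemma lookup_indicator_exponent: "lookup (indicator_exponent V) i = (if i \<in> V then 1 else 0)"
  by (simp add: indicator_exponent_def lookup_sum lookup_single when_def)

lemma indicator_exponent_empty [simp]: "indicator_exponent {} = 0"
  by (simp add: indicator_exponent_def)

lemma keys_indicator_exponent [simp]: "keys (indicator_exponent V) = V"
  by (auto simp: in_keys_iff lookup_indicator_exponent split: if_splits)

lemma exponent_degree_indicator: "exponent_degree (indicator_exponent V) = card V"
  by (simp add: exponent_degree_def lookup_indicator_exponent sum.If_cases)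

lemma set_monomial_eq_monom: "set_monomial V = monom (indicator_exponent V) 1"
proof (induction V rule: finite_induct[OF finite])
  case 2
  then show ?case
    by (simp add: set_monomial_def indicator_exponent_def indet_def mult_single)
qed (simp add: set_monomial_def)

lemma indicator_exponent_add_diff:
  assumes "V \<subseteq> keys k"
  shows "indicator_exponent V + (k - indicator_exponent V) = k"
  using assms by (intro exponent_diff_add) (auto simp: lookup_indicator_exponent in_keys_iff Suc_le_eq)

lemma keys_exponent_add: "keys (l + m) = keys l \<union> keys (m :: 'n \<Rightarrow>\<^sub>0 nat)"
  by (auto simp: in_keys_iff lookup_add)

section \<open>Ideals generated by squarefree monomials\<close>

text \<open>
  Membership in a monomial ideal is decided monomial by monomial; all ideals below, including the graded
  maximal ideal and the ideals of variables, are treated through this criterion.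
\<close>

lemma circuit_ideal_iff:
  fixes p :: "('n::finite, 'k::comm_ring_1) mpolynomial"
  shows "p \<in> circuit_ideal \<D> \<longleftrightarrow> (\<forall>m\<in>keys p. \<exists>G\<in>\<D>. G \<subseteq> keys m)"
proof
  assume "p \<in> circuit_ideal \<D>"
  then have "p \<in> module.span (*) (set_monomial ` \<D>)"
    by (simp add: circuit_ideal_def ideal_generated_by_def)
  then show "\<forall>m\<in>keys p. \<exists>G\<in>\<D>. G \<subseteq> keys m"
  proof (induction rule: module.span_induct_alt[OF module_times, consumes 1, case_names base step])
    case (step c x y)
    then obtain G where G: "G \<in> \<D>" "x = monom (indicator_exponent G) 1"
      by (auto simp: set_monomial_eq_monom)
    have "\<forall>m\<in>keys (c * x). G \<subseteq> keys m"
      using keys_mult[of c x] G(2) by (fastforce simp: keys_exponent_add)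
    with G(1) step(2) Poly_Mapping.keys_add[of "c * x" y] show ?case by blast
  qed simp
next
  assume *: "\<forall>m\<in>keys p. \<exists>G\<in>\<D>. G \<subseteq> keys m"
  have "monom m (lookup p m) \<in> module.span (*) (set_monomial ` \<D>)" if m: "m \<in> keys p" for m
  proof -
    obtain G where G: "G \<in> \<D>" "G \<subseteq> keys m" using * m by blast
    have "monom m (lookup p m) = monom (m - indicator_exponent G) (lookup p m) * set_monomial G"
      using indicator_exponent_add_diff[OF G(2)]
      by (simp add: set_monomial_eq_monom mult_single add.commute)
    with G(1) show ?thesis
      by (metis image_eqI module.span_base module.span_scale module_times)
  qed
  then show "p \<in> circuit_ideal \<D>"
    unfolding circuit_ideal_def ideal_generated_by_def
    by (subst sum_monom_keys[symmetric]) (rule module.span_sum[OF module_times])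
qed

lemma graded_maximal_ideal_iff:
  "p \<in> graded_maximal_ideal \<longleftrightarrow> lookup (p :: ('n::finite, 'k::comm_ring_1) mpolynomial) 0 = 0"
proof -
  have eq: "graded_maximal_ideal = (circuit_ideal (range (\<lambda>i. {i})) :: ('n, 'k) mpolynomial set)"
    by (simp add: graded_maximal_ideal_def circuit_ideal_def image_image set_monomial_def)
  have "(\<exists>G\<in>range (\<lambda>i. {i}). G \<subseteq> keys m) \<longleftrightarrow> m \<noteq> 0" for m :: "'n \<Rightarrow>\<^sub>0 nat"
    by (auto simp: in_keys_iff poly_mapping_eq_iff fun_eq_iff)
  then show ?thesis
    by (auto simp: eq circuit_ideal_iff in_keys_iff)
qed

lemma keys_monom_mult:
  fixes q :: "('n, 'k::comm_ring_1) mpolynomial"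
  shows "keys (q * monom e 1) = (\<lambda>m. e + m) ` keys q"
proof (intro set_eqI iffI)
  fix k assume k: "k \<in> keys (q * monom e 1)"
  then obtain m where m: "k = e + m"
    using keys_mult[of q "monom e 1"] by (fastforce simp: add.commute split: if_splits)
  with k have "m \<in> keys q"
    using lookup_monom_mult_add[of e 1 q m] by (auto simp: in_keys_iff mult.commute)
  with m show "k \<in> (\<lambda>m. e + m) ` keys q" by blast
next
  fix k assume "k \<in> (\<lambda>m. e + m) ` keys q"
  then show "k \<in> keys (q * monom e 1)"
    using lookup_monom_mult_add[of e 1 q] by (auto simp: in_keys_iff mult.commute)
qed

text \<open>
  The colon ideal by a squarefree monomial is obtained by deleting its variables from all generators,
  because \<open>G \<subseteq> F \<union> keys m\<close> if and only if \<open>G - F \<subseteq> keys m\<close>.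
\<close>

lemma circuit_ideal_colon:
  fixes q :: "('n::finite, 'k::comm_ring_1) mpolynomial"
  shows "q * set_monomial F \<in> circuit_ideal \<D> \<longleftrightarrow> q \<in> circuit_ideal ((\<lambda>G. G - F) ` \<D>)"
  by (auto simp: circuit_ideal_iff set_monomial_eq_monom keys_monom_mult keys_exponent_add Diff_subset_conv)

lemma circuit_ideal_insert_iff:
  "p \<in> circuit_ideal (insert F \<D>) \<longleftrightarrow> (\<exists>q. p - q * set_monomial F \<in> circuit_ideal \<D>)"
  by (simp add: circuit_ideal_def ideal_generated_by_def module.span_insert[OF module_times])

lemma circuit_ideal_plus:
  "circuit_ideal \<D> + ideal_generated_by {set_monomial F} =
    (circuit_ideal (insert F \<D>) :: ('n::finite, 'k::comm_ring_1) mpolynomial set)"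
proof -
  have "(set_monomial ` insert F \<D> :: ('n, 'k) mpolynomial set) = set_monomial ` \<D> \<union> {set_monomial F}"
    by simp
  then show ?thesis
    unfolding circuit_ideal_def ideal_generated_by_def set_plus_def
    by (simp only: module.span_Un[OF module_times]) blast
qed

lemma homogeneous_set_monomial: "homogeneous_of_degree (card F) (set_monomial F)"
  by (simp add: homogeneous_of_degree_def set_monomial_eq_monom exponent_degree_indicator)

lemma set_monomial_const_coeff:
  fixes F :: "'n::finite set"
  shows "F \<noteq> {} \<Longrightarrow> lookup (set_monomial F) 0 = 0"
  using keys_indicator_exponent[of F] 
  by (auto simp: set_monomial_eq_monom lookup_single when_def simp del: keys_indicator_exponent)

section \<open>Resolutions with the ring as term zero\<close>

text \<open>
  A minimal graded free resolution of \<open>I\<close> together with its augmentation, read as a resolution of \<open>S/I\<close>: term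
  \<open>0\<close> is \<open>S\<close> itself and the augmentation is the differential \<open>D 0\<close>, so that term \<open>i + 1\<close> is the
  \<open>i\<close>-th term of the resolution of \<open>I\<close>. In this form the augmentation needs no separate treatment in inductions, and the terms of a
  mapping cone are indexed uniformly. Vectors are arbitrary functions of which only the coordinates below the
  rank matter. Minimality is required from \<open>D 1\<close> on, since for \<open>I = S\<close> the entry of \<open>D 0\<close> is a unit.
\<close>

definition augmented_resolution ::
  "('n::finite, 'k::field) mpolynomial set \<Rightarrow> (nat \<Rightarrow> nat) \<Rightarrow> (nat \<Rightarrow> nat \<Rightarrow> nat) \<Rightarrow>
   (nat \<Rightarrow> nat \<Rightarrow> nat \<Rightarrow> ('n, 'k) mpolynomial) \<Rightarrow> bool" where
  "augmented_resolution I r a D \<longleftrightarrow>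
     r 0 = 1 \<and> a 0 0 = 0 \<and>
     (\<forall>i. \<forall>s<r i. \<forall>t<r (Suc i). \<forall>m\<in>keys (D i s t). exponent_degree m + a i s = a (Suc i) t) \<and>
     (\<forall>p. p \<in> I \<longleftrightarrow> (\<exists>v. p = (\<Sum>t<r 1. D 0 0 t * v t))) \<and>
     (\<forall>i v. (\<forall>s<r i. (\<Sum>t<r (Suc i). D i s t * v t) = 0) \<longleftrightarrow>
            (\<exists>w. \<forall>t<r (Suc i). v t = (\<Sum>k<r (Suc (Suc i)). D (Suc i) t k * w k))) \<and>
     (\<forall>i. \<forall>s<r (Suc i). \<forall>t<r (Suc (Suc i)). lookup (D (Suc i) s t) 0 = 0)"

lemma free_module_trunc: "(\<lambda>t. if t < r then v t else 0) \<in> free_module r"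
  by (simp add: free_module_def)

lemma in_matrix_map_image_iff:
  "v \<in> matrix_map r c A ` free_module c \<longleftrightarrow>
     v \<in> free_module r \<and> (\<exists>w. \<forall>s<r. v s = (\<Sum>t<c. A s t * w t))"
proof
  assume "v \<in> free_module r \<and> (\<exists>w. \<forall>s<r. v s = (\<Sum>t<c. A s t * w t))"
  then obtain w where "v \<in> free_module r" "\<forall>s<r. v s = (\<Sum>t<c. A s t * w t)" by blast
  then have "v = matrix_map r c A (\<lambda>t. if t < c then w t else 0)"
    by (auto simp: matrix_map_def free_module_def fun_eq_iff)
  then show "v \<in> matrix_map r c A ` free_module c"
    by (rule image_eqI[where f = "matrix_map r c A", OF _ free_module_trunc])
qed (auto simp: matrix_map_def free_module_def)

lemma kernel_eq_image_iff:
  fixes A B :: "nat \<Rightarrow> nat \<Rightarrow> 'a::comm_ring_1" and L :: "(nat \<Rightarrow> 'a) \<Rightarrow> bool"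
  assumes L: "\<And>v. L v \<longleftrightarrow> (\<forall>s<q. (\<Sum>t<r. B s t * v t) = 0)"
  shows "{v \<in> free_module r. L v} = matrix_map r c A ` free_module c \<longleftrightarrow>
     (\<forall>v. (\<forall>s<q. (\<Sum>t<r. B s t * v t) = 0) \<longleftrightarrow> (\<exists>w. \<forall>t<r. v t = (\<Sum>k<c. A t k * w k)))"
    (is "?K = ?M \<longleftrightarrow> (\<forall>v. ?P v \<longleftrightarrow> ?Q v)")
proof
  assume eq: "?K = ?M"
  show "\<forall>v. ?P v \<longleftrightarrow> ?Q v"
  proof
    fix v :: "nat \<Rightarrow> 'a"
    let ?v = "\<lambda>t. if t < r then v t else 0"
    have "?P v \<longleftrightarrow> ?v \<in> ?K" by (simp add: L free_module_trunc)
    also have "\<dots> \<longleftrightarrow> ?Q v" unfolding eq in_matrix_map_image_iff by (simp add: free_module_trunc)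
    finally show "?P v \<longleftrightarrow> ?Q v" .
  qed
next
  assume "\<forall>v. ?P v \<longleftrightarrow> ?Q v"
  then show "?K = ?M" unfolding set_eq_iff in_matrix_map_image_iff by (simp add: L)
qed

lemma image_free_module_eq_iff:
  fixes \<epsilon> :: "nat \<Rightarrow> 'a::comm_ring_1"
  shows "(\<lambda>v. \<Sum>t<r. v t * \<epsilon> t) ` free_module r = I \<longleftrightarrow> (\<forall>p. p \<in> I \<longleftrightarrow> (\<exists>v. p = (\<Sum>t<r. \<epsilon> t * v t)))"
proof -
  have "p \<in> (\<lambda>v. \<Sum>t<r. v t * \<epsilon> t) ` free_module r \<longleftrightarrow> (\<exists>v. p = (\<Sum>t<r. \<epsilon> t * v t))" (is "_ \<longleftrightarrow> ?R") for p
  proof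
    assume ?R
    then obtain v where "p = (\<Sum>t<r. \<epsilon> t * v t)" by blast
    then have "p = (\<Sum>t<r. (if t < r then v t else 0) * \<epsilon> t)" by (simp add: mult.commute)
    then show "p \<in> (\<lambda>v. \<Sum>t<r. v t * \<epsilon> t) ` free_module r"
      by (rule image_eqI[where f = "\<lambda>v. \<Sum>t<r. v t * \<epsilon> t", OF _ free_module_trunc])
  qed (auto simp: mult.commute)
  then show ?thesis by blast
qed

lemma all_nat_iff: "(\<forall>i. P i) \<longleftrightarrow> P 0 \<and> (\<forall>i. P (Suc i))"
  by (auto intro: nat_induct)

lemma minimal_graded_free_resolution_iff:
  assumes "r 0 = 1" and "a 0 0 = 0"
  shows "minimal_graded_free_resolution I (\<lambda>i. r (Suc i)) (\<lambda>i. a (Suc i)) (D 0 0) (\<lambda>i. D (Suc i))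
     \<longleftrightarrow> augmented_resolution I r a D"
proof -
  let ?graded = "\<lambda>i. \<forall>s<r i. \<forall>t<r (Suc i). \<forall>m\<in>keys (D i s t). exponent_degree m + a i s = a (Suc i) t"
  let ?exact = "\<lambda>i. \<forall>v. (\<forall>s<r i. (\<Sum>t<r (Suc i). D i s t * v t) = 0) \<longleftrightarrow>
            (\<exists>w. \<forall>t<r (Suc i). v t = (\<Sum>k<r (Suc (Suc i)). D (Suc i) t k * w k))"
  have "{v \<in> free_module (r (Suc 0)). (\<Sum>t < r (Suc 0). v t * D 0 0 t) = 0}
       = matrix_map (r (Suc 0)) (r (Suc 1)) (D (Suc 0)) ` free_module (r (Suc 1)) \<longleftrightarrow> ?exact 0"
    by (subst kernel_eq_image_iff[where q = "r 0" and B = "D 0"]) (simp_all add: assms(1) mult.commute)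
  moreover have "{v \<in> free_module (r (Suc (Suc i))).
        matrix_map (r (Suc i)) (r (Suc (Suc i))) (D (Suc i)) v = (\<lambda>_. 0)}
       = matrix_map (r (Suc (Suc i))) (r (Suc (Suc (Suc i)))) (D (Suc (Suc i))) ` free_module (r (Suc (Suc (Suc i))))
     \<longleftrightarrow> ?exact (Suc i)" for i
    by (subst kernel_eq_image_iff[where q = "r (Suc i)" and B = "D (Suc i)"])
       (auto simp: matrix_map_def fun_eq_iff)
  moreover have "(\<forall>i. ?graded i) \<longleftrightarrow>
      (\<forall>t < r (Suc 0). homogeneous_of_degree (a (Suc 0) t) (D 0 0 t)) \<and> (\<forall>i. ?graded (Suc i))"
    by (subst all_nat_iff) (simp add: homogeneous_of_degree_def assms)
  moreover have "(\<forall>i. ?exact i) \<longleftrightarrow> ?exact 0 \<and> (\<forall>i. ?exact (Suc i))"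
    by (rule all_nat_iff)
  ultimately show ?thesis
    unfolding minimal_graded_free_resolution_def image_free_module_eq_iff graded_maximal_ideal_iff
      augmented_resolution_def One_nat_def using assms[unfolded One_nat_def] by (simp only: simp_thms conj_ac)
qed

lemma augmented_resolution_of_minimal:
  assumes "minimal_graded_free_resolution I r a \<epsilon> A"
  obtains D where "augmented_resolution I (case_nat 1 r) (case_nat (\<lambda>_. 0) a) D"
proof
  show "augmented_resolution I (case_nat 1 r) (case_nat (\<lambda>_. 0) a) (case_nat (\<lambda>_. \<epsilon>) A)"
    using assms by (subst minimal_graded_free_resolution_iff[symmetric]) simp_all
qed

section \<open>Comparison of resolutions and uniqueness of Betti numbers\<close>

definition mat_prod :: "nat \<Rightarrow> (nat \<Rightarrow> nat \<Rightarrow> 'a::comm_ring_1) \<Rightarrow> (nat \<Rightarrow> nat \<Rightarrow> 'a) \<Rightarrow> nat \<Rightarrow> nat \<Rightarrow> 'a" where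
  "mat_prod n A B s t = (\<Sum>k<n. A s k * B k t)"

lemma mat_prod_assoc: "mat_prod m (mat_prod n A B) C s t = mat_prod n A (mat_prod m B C) s t"
proof -
  have "mat_prod m (mat_prod n A B) C s t = (\<Sum>k<m. \<Sum>l<n. A s l * B l k * C k t)"
    by (simp add: mat_prod_def sum_distrib_right)
  also have "\<dots> = (\<Sum>l<n. \<Sum>k<m. A s l * B l k * C k t)"
    by (rule sum.swap)
  also have "\<dots> = mat_prod n A (mat_prod m B C) s t"
    by (simp add: mat_prod_def sum_distrib_left mult.assoc)
  finally show ?thesis .
qed

lemma mat_prod_cong:
  assumes "\<And>k. k < n \<Longrightarrow> A s k = A' s k" "\<And>k. k < n \<Longrightarrow> B k t = B' k t"
  shows "mat_prod n A B s t = mat_prod n A' B' s t"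
  using assms by (simp add: mat_prod_def)

lemma mat_prod_1_left:
  "s < n \<Longrightarrow> mat_prod n (\<lambda>s t. if s = t then 1 else 0) B s t = B s t"
  by (simp add: mat_prod_def if_distrib[of "\<lambda>x. x * _"] cong: if_cong)

lemma mat_prod_1_right:
  "t < n \<Longrightarrow> mat_prod n A (\<lambda>s t. if s = t then 1 else 0) s t = A s t"
  by (simp add: mat_prod_def if_distrib[of "\<lambda>x. _ * x"] cong: if_cong)

lemma mat_prod_diff_right:
  "mat_prod n A (\<lambda>s t. B s t - C s t) s t = mat_prod n A B s t - mat_prod n A C s t"
  by (simp add: mat_prod_def right_diff_distrib sum_subtractf)

lemma mat_prod_diff_left:
  "mat_prod n (\<lambda>s t. A s t - B s t) C s t = mat_prod n A C s t - mat_prod n B C s t"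
  by (simp add: mat_prod_def left_diff_distrib sum_subtractf)

context
  fixes I :: "('n::finite, 'k::field) mpolynomial set" and r a D
  assumes res: "augmented_resolution I r a D"
begin

lemma resolution_rank_0: "r 0 = 1" and resolution_shift_0: "a 0 0 = 0"
  using res by (simp_all add: augmented_resolution_def)

lemma resolution_graded:
  "s < r i \<Longrightarrow> t < r (Suc i) \<Longrightarrow> m \<in> keys (D i s t) \<Longrightarrow> exponent_degree m + a i s = a (Suc i) t"
  using res by (simp add: augmented_resolution_def)

lemma resolution_ideal_iff: "p \<in> I \<longleftrightarrow> (\<exists>v. p = (\<Sum>t<r (Suc 0). D 0 0 t * v t))"
  using res by (simp add: augmented_resolution_def)

lemma resolution_generator_in_ideal: "t < r (Suc 0) \<Longrightarrow> D 0 0 t \<in> I"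
  by (auto simp: resolution_ideal_iff if_distrib[of "\<lambda>x. _ * x"] cong: if_cong
      intro!: exI[of _ "\<lambda>k. if k = t then 1 else 0"])

lemma resolution_exact_iff:
  "(\<forall>s<r i. (\<Sum>t<r (Suc i). D i s t * v t) = 0) \<longleftrightarrow>
     (\<exists>w. \<forall>t<r (Suc i). v t = (\<Sum>k<r (Suc (Suc i)). D (Suc i) t k * w k))"
proof -
  from res have "\<forall>i v. (\<forall>s<r i. (\<Sum>t<r (Suc i). D i s t * v t) = 0) \<longleftrightarrow>
     (\<exists>w. \<forall>t<r (Suc i). v t = (\<Sum>k<r (Suc (Suc i)). D (Suc i) t k * w k))"
    unfolding augmented_resolution_def by (elim conjE)
  then show ?thesis by (elim allE)
qed

lemma resolution_exact:
  assumes "\<And>s. s < r i \<Longrightarrow> (\<Sum>t<r (Suc i). D i s t * v t) = 0"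
  shows "\<exists>w. \<forall>t<r (Suc i). v t = (\<Sum>k<r (Suc (Suc i)). D (Suc i) t k * w k)"
  using assms resolution_exact_iff[of i v] by simp

lemma resolution_complex_apply:
  assumes "s < r i"
  shows "(\<Sum>t<r (Suc i). D i s t * (\<Sum>k<r (Suc (Suc i)). D (Suc i) t k * w k)) = 0"
  using assms resolution_exact_iff[of i "\<lambda>t. \<Sum>k<r (Suc (Suc i)). D (Suc i) t k * w k"] by blast

lemma resolution_complex:
  assumes "s < r i" "k < r (Suc (Suc i))"
  shows "mat_prod (r (Suc i)) (D i) (D (Suc i)) s k = 0"
  using resolution_complex_apply[OF assms(1), of "\<lambda>l. if l = k then 1 else 0"] assms(2)
  by (simp add: mat_prod_def if_distrib[of "\<lambda>x. _ * x"] cong: if_cong)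

lemma resolution_minimal:
  "s < r (Suc i) \<Longrightarrow> t < r (Suc (Suc i)) \<Longrightarrow> lookup (D (Suc i) s t) 0 = 0"
  using res by (simp add: augmented_resolution_def)

end

text \<open>
  Free modules are projective: columns in the image of \<open>D\<close> lift along \<open>D\<close>. An arbitrary lift becomes
  homogeneous after keeping only the homogeneous components of the right degree, and this does
  not change its image because \<open>D\<close> and \<open>f\<close> are homogeneous.
\<close>

lemma graded_matrix_lift:
  fixes D f :: "nat \<Rightarrow> nat \<Rightarrow> ('n::finite, 'k::field) mpolynomial"
  assumes lift: "\<And>t. t < c \<Longrightarrow> \<exists>w. \<forall>s<r. f s t = (\<Sum>k<q. D s k * w k)"
    and D: "\<And>s k m. s < r \<Longrightarrow> k < q \<Longrightarrow> m \<in> keys (D s k) \<Longrightarrow> exponent_degree m + a s = b k"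
    and f: "\<And>s t m. s < r \<Longrightarrow> t < c \<Longrightarrow> m \<in> keys (f s t) \<Longrightarrow> exponent_degree m + a s = e t"
  obtains g where "\<And>s t. s < r \<Longrightarrow> t < c \<Longrightarrow> mat_prod q D g s t = f s t"
    and "\<And>k t m. k < q \<Longrightarrow> t < c \<Longrightarrow> m \<in> keys (g k t) \<Longrightarrow> exponent_degree m + b k = e t"
proof -
  obtain w where w: "\<And>s t. t < c \<Longrightarrow> s < r \<Longrightarrow> f s t = (\<Sum>k<q. D s k * w t k)"
    using lift by metis
  let ?P = "\<lambda>b t m. exponent_degree m + b = e t"
  let ?g = "\<lambda>k t. part_where (?P (b k) t) (w t k)"
  show thesis
  proof (rule that[of ?g])
    fix s t assume st: "s < r" "t < c"
    have "D s k * ?g k t = part_where (?P (a s) t) (D s k * w t k)" if "k < q" for k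
    proof (rule part_where_mult[symmetric])
      fix l m assume "l \<in> keys (D s k)"
      with D[OF st(1) that] have "exponent_degree l + a s = b k" by blast
      then show "?P (a s) t (l + m) \<longleftrightarrow> ?P (b k) t m"
        by (auto simp: exponent_degree_add)
    qed
    then have "mat_prod q D ?g s t = part_where (?P (a s) t) (f s t)"
      by (simp add: mat_prod_def part_where_sum w st)
    also have "\<dots> = f s t"
      by (rule part_where_eq_self) (rule f[OF st])
    finally show "mat_prod q D ?g s t = f s t" .
  qed (simp add: keys_part_where)
qed

lemma keys_mat_prodE:
  fixes A B :: "nat \<Rightarrow> nat \<Rightarrow> ('n, 'k::field) mpolynomial"
  assumes "m \<in> keys (mat_prod n A B s t)"
  obtains k l l' where "k < n" "l \<in> keys (A s k)" "l' \<in> keys (B k t)" "m = l + l'"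
proof -
  obtain k where "k < n" "m \<in> keys (A s k * B k t)"
    using assms keys_sum[of "\<lambda>k. A s k * B k t" "{..<n}"] by (auto simp: mat_prod_def)
  with that keys_mult[of "A s k" "B k t"] show thesis by blast
qed

text \<open>
  The comparison theorem: multiplication by \<open>h\<close> induces a map \<open>S/P \<rightarrow> S/I\<close>, which lifts to the resolutions.
  The case \<open>h = 1\<close>, \<open>P = I\<close> compares two resolutions of one ideal; the general case supplies the mapping cone.
\<close>

lemma comparison_chain_map:
  fixes I P :: "('n::finite, 'k::field) mpolynomial set"
  assumes P: "augmented_resolution P rP aP DP" and I: "augmented_resolution I r a D"
    and h: "homogeneous_of_degree \<eta> h" and hP: "\<And>q. q \<in> P \<Longrightarrow> h * q \<in> I"
  obtains \<Gamma> where "\<Gamma> 0 0 0 = h"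
    and "\<And>i s t. s < r i \<Longrightarrow> t < rP (Suc i) \<Longrightarrow>
           mat_prod (r (Suc i)) (D i) (\<Gamma> (Suc i)) s t = mat_prod (rP i) (\<Gamma> i) (DP i) s t"
    and "\<And>i s t m. s < r i \<Longrightarrow> t < rP i \<Longrightarrow> m \<in> keys (\<Gamma> i s t) \<Longrightarrow>
           exponent_degree m + a i s = aP i t + \<eta>"
proof -
  \<comment> \<open>\<open>liftable\<close> is the invariant of the recursion: it says that the next map exists, and exactness passes it on.\<close>
  define graded where "graded i G \<longleftrightarrow> (\<forall>s<r i. \<forall>t<rP i. \<forall>m\<in>keys (G s t).
      exponent_degree m + a i s = aP i t + \<eta>)" for i and G :: "nat \<Rightarrow> nat \<Rightarrow> ('n, 'k) mpolynomial"
  define liftable where "liftable i G \<longleftrightarrow> (\<forall>t<rP (Suc i). \<exists>w. \<forall>s<r i.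
      mat_prod (rP i) G (DP i) s t = (\<Sum>k<r (Suc i). D i s k * w k))"
    for i and G :: "nat \<Rightarrow> nat \<Rightarrow> ('n, 'k) mpolynomial"
  define comm where "comm i G G' \<longleftrightarrow> (\<forall>s<r i. \<forall>t<rP (Suc i).
      mat_prod (r (Suc i)) (D i) G' s t = mat_prod (rP i) G (DP i) s t)" for i G G'
  have "\<exists>\<Gamma>. \<forall>i. ((graded i (\<Gamma> i) \<and> liftable i (\<Gamma> i)) \<and> (i = 0 \<longrightarrow> \<Gamma> i 0 0 = h)) \<and> comm i (\<Gamma> i) (\<Gamma> (Suc i))"
  proof (rule dependent_nat_choice)
    have "\<exists>w. h * DP 0 0 t = (\<Sum>k<r (Suc 0). D 0 0 k * w k)" if "t < rP (Suc 0)" for t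
      using hP[OF resolution_generator_in_ideal[OF P that]] unfolding resolution_ideal_iff[OF I] .
    then show "\<exists>G. (graded 0 G \<and> liftable 0 G) \<and> (0 = 0 \<longrightarrow> G 0 0 = h)"
      using h resolution_rank_0[OF I] resolution_shift_0[OF I]
        resolution_rank_0[OF P] resolution_shift_0[OF P]
      by (intro exI[of _ "\<lambda>_ _. h"])
         (auto simp: graded_def liftable_def homogeneous_of_degree_def mat_prod_def)
  next
    fix G i assume "(graded i G \<and> liftable i G) \<and> (i = 0 \<longrightarrow> G 0 0 = h)"
    then have G: "graded i G" "liftable i G" by auto
    obtain G' where comm: "\<And>s t. s < r i \<Longrightarrow> t < rP (Suc i) \<Longrightarrow>
        mat_prod (r (Suc i)) (D i) G' s t = mat_prod (rP i) G (DP i) s t"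
      and G': "\<And>k t m. k < r (Suc i) \<Longrightarrow> t < rP (Suc i) \<Longrightarrow> m \<in> keys (G' k t) \<Longrightarrow>
        exponent_degree m + a (Suc i) k = aP (Suc i) t + \<eta>"
    proof (rule graded_matrix_lift)
      show "\<exists>w. \<forall>s<r i. mat_prod (rP i) G (DP i) s t = (\<Sum>k<r (Suc i). D i s k * w k)"
        if "t < rP (Suc i)" for t
        using G(2) that unfolding liftable_def by blast
      show "exponent_degree m + a i s = a (Suc i) k"
        if "s < r i" "k < r (Suc i)" "m \<in> keys (D i s k)" for s k m
        using resolution_graded[OF I that] .
      show "exponent_degree m + a i s = aP (Suc i) t + \<eta>"
        if st: "s < r i" "t < rP (Suc i)" and m: "m \<in> keys (mat_prod (rP i) G (DP i) s t)" for s t m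
      proof -
        from m obtain k l l' where "k < rP i" "l \<in> keys (G s k)" "l' \<in> keys (DP i k t)" "m = l + l'"
          by (rule keys_mat_prodE)
        then show ?thesis
          using G(1) st resolution_graded[OF P, of k i t l']
          by (fastforce simp: graded_def exponent_degree_add)
      qed
    qed blast
    have "liftable (Suc i) G'"
      unfolding liftable_def
    proof (intro allI impI resolution_exact[OF I])
      fix t s assume t: "t < rP (Suc (Suc i))" and s: "s < r i"
      have "mat_prod (r (Suc i)) (D i) (mat_prod (rP (Suc i)) G' (DP (Suc i))) s t
          = mat_prod (rP (Suc i)) (mat_prod (r (Suc i)) (D i) G') (DP (Suc i)) s t"
        by (simp add: mat_prod_assoc)
      also have "\<dots> = mat_prod (rP (Suc i)) (mat_prod (rP i) G (DP i)) (DP (Suc i)) s t"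
        by (rule mat_prod_cong) (simp_all add: comm s)
      also have "\<dots> = mat_prod (rP i) G (mat_prod (rP (Suc i)) (DP i) (DP (Suc i))) s t"
        by (rule mat_prod_assoc)
      also have "\<dots> = 0"
        unfolding mat_prod_def[of "rP i" G] by (simp add: resolution_complex[OF P _ t])
      finally show "(\<Sum>k<r (Suc i). D i s k * mat_prod (rP (Suc i)) G' (DP (Suc i)) k t) = 0"
        by (simp add: mat_prod_def)
    qed
    moreover have "graded (Suc i) G'" using G' by (simp add: graded_def)
    moreover have "comm i G G'" using comm by (simp add: comm_def)
    ultimately show "\<exists>G'. ((graded (Suc i) G' \<and> liftable (Suc i) G') \<and> (Suc i = 0 \<longrightarrow> G' 0 0 = h)) \<and> comm i G G'"
      by blast
  qed
  then obtain \<Gamma> where "\<Gamma> 0 0 0 = h" "\<And>i. graded i (\<Gamma> i)" "\<And>i. comm i (\<Gamma> i) (\<Gamma> (Suc i))"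
    by blast
  with that show thesis unfolding graded_def comm_def by blast
qed

text \<open>
  A chain map lifting the identity is homotopic to the identity. The two terms of \<open>D h + h D\<close> have no constant terms,
  because the differentials \<open>D (i + 1)\<close> have none; in the only place where
  \<open>D 0\<close> would enter, it is multiplied by \<open>h 0\<close>, which is chosen to be \<open>0\<close>.
\<close>

lemma chain_endomorphism_const_coeff:
  fixes I :: "('n::finite, 'k::field) mpolynomial set"
  assumes I: "augmented_resolution I r a D"
    and \<phi>0: "\<phi> 0 0 0 = 1"
    and \<phi>: "\<And>i s t. s < r i \<Longrightarrow> t < r (Suc i) \<Longrightarrow>
           mat_prod (r (Suc i)) (D i) (\<phi> (Suc i)) s t = mat_prod (r i) (\<phi> i) (D i) s t"
    and st: "s < r (Suc i)" "t < r (Suc i)"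
  shows "lookup (\<phi> (Suc i) s t) 0 = (if s = t then 1 else 0)"
proof -
  let ?one = "\<lambda>s t. if s = t then 1 else (0 :: ('n, 'k) mpolynomial)"
  define liftable where "liftable i h \<longleftrightarrow> (\<forall>t<r (Suc i). \<exists>w. \<forall>s<r (Suc i).
      \<phi> (Suc i) s t - ?one s t - mat_prod (r i) h (D i) s t = (\<Sum>k<r (Suc (Suc i)). D (Suc i) s k * w k))"
    for i and h :: "nat \<Rightarrow> nat \<Rightarrow> ('n, 'k) mpolynomial"
  define homotopy where "homotopy i h h' \<longleftrightarrow> (\<forall>s<r (Suc i). \<forall>t<r (Suc i).
      \<phi> (Suc i) s t - ?one s t - mat_prod (r i) h (D i) s t = mat_prod (r (Suc (Suc i))) (D (Suc i)) h' s t)"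
    for i h h'
  have "\<exists>h. \<forall>i. (liftable i (h i) \<and> (i = 0 \<longrightarrow> h i = (\<lambda>_ _. 0))) \<and> homotopy i (h i) (h (Suc i))"
  proof (rule dependent_nat_choice)
    have "liftable 0 (\<lambda>_ _. 0)"
      unfolding liftable_def
    proof (intro allI impI resolution_exact[OF I])
      fix t s assume t: "t < r (Suc 0)" and s: "s < r 0"
      then have [simp]: "s = 0" using resolution_rank_0[OF I] by simp
      have "mat_prod (r (Suc 0)) (D 0) (\<lambda>s t. \<phi> (Suc 0) s t - ?one s t - mat_prod (r 0) (\<lambda>_ _. 0) (D 0) s t) s t
         = mat_prod (r (Suc 0)) (D 0) (\<lambda>s t. \<phi> (Suc 0) s t - ?one s t) s t"
        by (simp add: mat_prod_def)
      also have "\<dots> = mat_prod (r 0) (\<phi> 0) (D 0) s t - D 0 s t"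
        using \<phi>[OF s t] by (simp add: mat_prod_diff_right mat_prod_1_right t)
      also have "\<dots> = 0" by (simp add: mat_prod_def resolution_rank_0[OF I] \<phi>0)
      finally show "(\<Sum>k<r (Suc 0). D 0 s k * (\<phi> (Suc 0) k t - ?one k t -
            mat_prod (r 0) (\<lambda>_ _. 0) (D 0) k t)) = 0"
        by (simp add: mat_prod_def)
    qed
    then show "\<exists>h. liftable 0 h \<and> (0 = 0 \<longrightarrow> h = (\<lambda>_ _. 0))" by blast
  next
    fix h i assume "liftable i h \<and> (i = 0 \<longrightarrow> h = (\<lambda>_ _. 0))"
    then have "\<forall>t. \<exists>w. t < r (Suc i) \<longrightarrow> (\<forall>s<r (Suc i).
      \<phi> (Suc i) s t - ?one s t - mat_prod (r i) h (D i) s t = (\<Sum>k<r (Suc (Suc i)). D (Suc i) s k * w k))"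
      unfolding liftable_def by blast
    from choice[OF this] obtain w where w: "\<And>s t. s < r (Suc i) \<Longrightarrow> t < r (Suc i) \<Longrightarrow>
      \<phi> (Suc i) s t - ?one s t - mat_prod (r i) h (D i) s t = (\<Sum>k<r (Suc (Suc i)). D (Suc i) s k * w t k)"
      by blast
    define h' where "h' k t = w t k" for k t
    have h': "mat_prod (r (Suc (Suc i))) (D (Suc i)) h' s t =
        \<phi> (Suc i) s t - ?one s t - mat_prod (r i) h (D i) s t" if "s < r (Suc i)" "t < r (Suc i)" for s t
      unfolding w[OF that] by (simp add: h'_def mat_prod_def)
    have "liftable (Suc i) h'"
      unfolding liftable_def
    proof (intro allI impI resolution_exact[OF I])
      fix t s assume t: "t < r (Suc (Suc i))" and s: "s < r (Suc i)"
      have "mat_prod (r (Suc (Suc i))) (D (Suc i)) (mat_prod (r (Suc i)) h' (D (Suc i))) s t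
          = mat_prod (r (Suc i)) (mat_prod (r (Suc (Suc i))) (D (Suc i)) h') (D (Suc i)) s t"
        by (simp add: mat_prod_assoc)
      also have "\<dots> = mat_prod (r (Suc i)) (\<lambda>s t. \<phi> (Suc i) s t - ?one s t - mat_prod (r i) h (D i) s t) (D (Suc i)) s t"
        by (rule mat_prod_cong) (simp_all add: h' s)
      also have "\<dots> = mat_prod (r (Suc i)) (\<phi> (Suc i)) (D (Suc i)) s t - D (Suc i) s t
           - mat_prod (r i) h (mat_prod (r (Suc i)) (D i) (D (Suc i))) s t"
        by (simp add: mat_prod_diff_left mat_prod_1_left s mat_prod_assoc)
      also have "mat_prod (r i) h (mat_prod (r (Suc i)) (D i) (D (Suc i))) s t = 0"
        unfolding mat_prod_def[of "r i" h] by (simp add: resolution_complex[OF I _ t])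
      finally have "mat_prod (r (Suc (Suc i))) (D (Suc i)) (\<lambda>s t. \<phi> (Suc (Suc i)) s t - ?one s t -
            mat_prod (r (Suc i)) h' (D (Suc i)) s t) s t = 0"
        by (simp add: mat_prod_diff_right mat_prod_1_right t \<phi> s)
      then show "(\<Sum>k<r (Suc (Suc i)). D (Suc i) s k * (\<phi> (Suc (Suc i)) k t - ?one k t -
            mat_prod (r (Suc i)) h' (D (Suc i)) k t)) = 0"
        by (simp add: mat_prod_def)
    qed
    moreover have "homotopy i h h'" by (simp add: homotopy_def h')
    ultimately show "\<exists>h'. (liftable (Suc i) h' \<and> (Suc i = 0 \<longrightarrow> h' = (\<lambda>_ _. 0))) \<and> homotopy i h h'"
      by blast
  qed
  then obtain h where h0: "h 0 = (\<lambda>_ _. 0)" and h: "\<And>i. homotopy i (h i) (h (Suc i))"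
    by blast
  have "lookup (mat_prod (r (Suc (Suc i))) (D (Suc i)) (h (Suc i)) s t) 0 = 0"
    using st by (simp add: mat_prod_def const_coeff_sum_mult resolution_minimal[OF I])
  moreover have "lookup (mat_prod (r i) (h i) (D i) s t) 0 = 0"
    using st by (cases i) (simp_all add: h0 mat_prod_def const_coeff_sum_mult resolution_minimal[OF I])
  moreover have "\<phi> (Suc i) s t - ?one s t - mat_prod (r i) (h i) (D i) s t =
      mat_prod (r (Suc (Suc i))) (D (Suc i)) (h (Suc i)) s t"
    using h[of i] st by (simp add: homotopy_def)
  then have "\<phi> (Suc i) s t = ?one s t + mat_prod (r i) (h i) (D i) s t +
      mat_prod (r (Suc (Suc i))) (D (Suc i)) (h (Suc i)) s t"
    by (simp add: algebra_simps)
  ultimately show ?thesis by (simp add: lookup_add)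
qed

lemma sum_fun_apply: "(\<Sum>x\<in>A. f x) s = (\<Sum>x\<in>A. f x s)"
  by (induction A rule: infinite_finite_induct) (auto simp: zero_fun_def)

text \<open>
  The columns of a matrix with a left inverse are linearly independent, so they are no more numerous than
  the rows.
\<close>

lemma card_le_of_left_inverse:
  fixes p q :: "nat \<Rightarrow> nat \<Rightarrow> 'k::field"
  assumes fin: "finite T" "finite T'"
    and pq: "\<And>t t'. t \<in> T \<Longrightarrow> t' \<in> T \<Longrightarrow> (\<Sum>s\<in>T'. p t s * q s t') = (if t = t' then 1 else 0)"
  shows "card T \<le> card T'"
proof -
  interpret vector_space "\<lambda>(c::'k) (f::nat \<Rightarrow> 'k) s. c * f s"
    by unfold_locales (auto simp: algebra_simps)
  define u where "u t s = (if s \<in> T' then q s t else 0)" for t s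
  define b where "b s = (\<lambda>s'. if s' = s then (1::'k) else 0)" for s :: nat
  have pu: "(\<Sum>s\<in>T'. p t s * u t' s) = (if t = t' then 1 else 0)" if "t \<in> T" "t' \<in> T" for t t'
    using pq[OF that] by (simp add: u_def)
  have inj: "inj_on u T"
    using pu by (intro inj_onI) (metis zero_neq_one)
  have "independent (u ` T)"
  proof (rule independent_if_scalars_zero)
    fix f x assume 0: "(\<Sum>x\<in>u ` T. (\<lambda>s. f x * x s)) = 0" and "x \<in> u ` T"
    then obtain t where t: "t \<in> T" "x = u t" by blast
    have 0: "(\<Sum>t\<in>T. f (u t) * u t s) = 0" for s
      using fun_cong[OF 0, of s] by (simp add: sum.reindex[OF inj] sum_fun_apply)
    have "0 = (\<Sum>s\<in>T'. p t s * (\<Sum>t'\<in>T. f (u t') * u t' s))" by (simp add: 0)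
    also have "\<dots> = (\<Sum>s\<in>T'. \<Sum>t'\<in>T. f (u t') * (p t s * u t' s))"
      by (simp add: sum_distrib_left mult_ac)
    also have "\<dots> = (\<Sum>t'\<in>T. f (u t') * (\<Sum>s\<in>T'. p t s * u t' s))"
      by (subst sum.swap) (simp add: sum_distrib_left)
    also have "\<dots> = f (u t)"
      using t fin by (simp add: pu if_distrib[of "\<lambda>x. _ * x"] cong: if_cong)
    finally show "f x = 0" using t by simp
  qed (use fin in simp)
  moreover have "u ` T \<subseteq> span (b ` T')"
  proof safe
    fix t assume "t \<in> T"
    have "u t = (\<Sum>s\<in>T'. (\<lambda>s'. q s t * b s s'))"
      using fin by (auto simp: fun_eq_iff sum_fun_apply u_def b_def if_distrib[of "\<lambda>x. _ * x"] cong: if_cong)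
    also have "\<dots> \<in> span (b ` T')"
      by (intro span_sum span_scale span_base) auto
    finally show "u t \<in> span (b ` T')" .
  qed
  ultimately have "card (u ` T) \<le> card (b ` T')"
    using fin independent_span_bound[of "b ` T'" "u ` T"] by blast
  then show ?thesis
    using card_image[OF inj] card_image_le[OF fin(2), of b] by linarith
qed

text \<open>
  The constant terms of one comparison map form a left inverse of those of the other, and homogeneity
  lets a constant be nonzero only between basis elements of equal degree. So the left inverse
  restricts to the basis elements of degree \<open>j\<close>.
\<close>

lemma resolution_card_le:
  fixes I :: "('n::finite, 'k::field) mpolynomial set"
  assumes I: "augmented_resolution I r a D" and I': "augmented_resolution I r' a' D'"
  shows "card {t. t < r (Suc i) \<and> a (Suc i) t = j} \<le> card {t. t < r' (Suc i) \<and> a' (Suc i) t = j}"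
proof -
  have one: "homogeneous_of_degree 0 (1 :: ('n, 'k) mpolynomial)"
    by (simp add: homogeneous_of_degree_def)
  obtain \<Gamma> where \<Gamma>: "\<Gamma> 0 0 0 = 1" "\<And>i s t. s < r' i \<Longrightarrow> t < r (Suc i) \<Longrightarrow>
           mat_prod (r' (Suc i)) (D' i) (\<Gamma> (Suc i)) s t = mat_prod (r i) (\<Gamma> i) (D i) s t"
    and \<Gamma>_deg: "\<And>i s t m. s < r' i \<Longrightarrow> t < r i \<Longrightarrow> m \<in> keys (\<Gamma> i s t) \<Longrightarrow>
           exponent_degree m + a' i s = a i t + 0"
    by (rule comparison_chain_map[OF I I' one]) auto
  obtain \<Gamma>' where \<Gamma>': "\<Gamma>' 0 0 0 = 1" "\<And>i s t. s < r i \<Longrightarrow> t < r' (Suc i) \<Longrightarrow>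
           mat_prod (r (Suc i)) (D i) (\<Gamma>' (Suc i)) s t = mat_prod (r' i) (\<Gamma>' i) (D' i) s t"
    by (rule comparison_chain_map[OF I' I one]) auto
  define \<phi> where "\<phi> i = mat_prod (r' i) (\<Gamma>' i) (\<Gamma> i)" for i
  have "\<phi> 0 0 0 = 1"
    by (simp add: \<phi>_def mat_prod_def resolution_rank_0[OF I'] \<Gamma> \<Gamma>')
  moreover have "mat_prod (r (Suc i)) (D i) (\<phi> (Suc i)) s t = mat_prod (r i) (\<phi> i) (D i) s t"
    if st: "s < r i" "t < r (Suc i)" for i s t
  proof -
    have "mat_prod (r (Suc i)) (D i) (\<phi> (Suc i)) s t
        = mat_prod (r' (Suc i)) (mat_prod (r (Suc i)) (D i) (\<Gamma>' (Suc i))) (\<Gamma> (Suc i)) s t"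
      by (simp add: \<phi>_def mat_prod_assoc)
    also have "\<dots> = mat_prod (r' (Suc i)) (mat_prod (r' i) (\<Gamma>' i) (D' i)) (\<Gamma> (Suc i)) s t"
      by (rule mat_prod_cong) (simp_all add: \<Gamma>' st)
    also have "\<dots> = mat_prod (r' i) (\<Gamma>' i) (mat_prod (r' (Suc i)) (D' i) (\<Gamma> (Suc i))) s t"
      by (rule mat_prod_assoc)
    also have "\<dots> = mat_prod (r' i) (\<Gamma>' i) (mat_prod (r i) (\<Gamma> i) (D i)) s t"
      by (rule mat_prod_cong) (simp_all add: \<Gamma> st)
    finally show ?thesis by (simp add: \<phi>_def mat_prod_assoc)
  qed
  ultimately have const: "lookup (\<phi> (Suc i) s t) 0 = (if s = t then 1 else 0)"
    if "s < r (Suc i)" "t < r (Suc i)" for s t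
    by (rule chain_endomorphism_const_coeff[OF I _ _ that])
  let ?T = "{t. t < r (Suc i) \<and> a (Suc i) t = j}" and ?T' = "{t. t < r' (Suc i) \<and> a' (Suc i) t = j}"
  have "(\<Sum>s\<in>?T'. lookup (\<Gamma>' (Suc i) t s) 0 * lookup (\<Gamma> (Suc i) s t') 0) = (if t = t' then 1 else 0)"
    if t: "t \<in> ?T" "t' \<in> ?T" for t t'
  proof -
    have "lookup (\<Gamma> (Suc i) s t') 0 = 0" if "s < r' (Suc i)" "a' (Suc i) s \<noteq> j" for s
      using \<Gamma>_deg[of s "Suc i" t' 0] that t by (auto simp: in_keys_iff)
    then have "(\<Sum>s\<in>?T'. lookup (\<Gamma>' (Suc i) t s) 0 * lookup (\<Gamma> (Suc i) s t') 0) =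
        (\<Sum>s<r' (Suc i). lookup (\<Gamma>' (Suc i) t s) 0 * lookup (\<Gamma> (Suc i) s t') 0)"
      by (intro sum.mono_neutral_left) auto
    also have "\<dots> = lookup (\<phi> (Suc i) t t') 0"
      by (simp add: \<phi>_def mat_prod_def const_coeff_sum_mult)
    finally show ?thesis using const t by simp
  qed
  then show ?thesis
    by (intro card_le_of_left_inverse[where p = "\<lambda>t s. lookup (\<Gamma>' (Suc i) t s) 0"
          and q = "\<lambda>s t. lookup (\<Gamma> (Suc i) s t) 0"]) simp_all
qed

theorem graded_betti_eq_card:
  assumes I: "augmented_resolution I r a D"
  shows "graded_betti I i j = card {t. t < r (Suc i) \<and> a (Suc i) t = j}"
  unfolding graded_betti_def
proof (rule the_equality)
  show "\<exists>r' a' \<epsilon> A. minimal_graded_free_resolution I r' a' \<epsilon> A \<and>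
      card {t. t < r (Suc i) \<and> a (Suc i) t = j} = card {t. t < r' i \<and> a' i t = j}"
    using minimal_graded_free_resolution_iff[of r a I D] I
    by (auto simp: augmented_resolution_def intro!: exI[of _ "\<lambda>i. r (Suc i)"] exI[of _ "\<lambda>i. a (Suc i)"])
next
  fix b assume "\<exists>r' a' \<epsilon> A. minimal_graded_free_resolution I r' a' \<epsilon> A \<and> b = card {t. t < r' i \<and> a' i t = j}"
  then obtain r' a' \<epsilon> A where min: "minimal_graded_free_resolution I r' a' \<epsilon> A"
    and b: "b = card {t. t < r' i \<and> a' i t = j}" by blast
  obtain D' where "augmented_resolution I (case_nat 1 r') (case_nat (\<lambda>_. 0) a') D'"
    by (rule augmented_resolution_of_minimal[OF min])
  from resolution_card_le[OF this I, of i j] resolution_card_le[OF I this, of i j]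
  show "b = card {t. t < r (Suc i) \<and> a (Suc i) t = j}" by (simp add: b)
qed

section \<open>Adding a generator by a minimal mapping cone\<close>

lemma sum_lessThan_add:
  fixes f :: "nat \<Rightarrow> 'a::comm_monoid_add"
  shows "(\<Sum>t<m + n. f t) = (\<Sum>t<m. f t) + (\<Sum>t<n. f (m + t))"
  by (induction n) (simp_all add: add.assoc)

lemma all_less_add: "(\<forall>t<m + n. P t) \<longleftrightarrow> (\<forall>t<m. P t) \<and> (\<forall>t<n. P (m + t))" for m n :: nat
  by (metis add_less_cancel_left le_add_diff_inverse not_less trans_less_add1)

lemma ex_less_add: "(\<exists>t<m + n. P t) \<longleftrightarrow> (\<exists>t<m. P t) \<or> (\<exists>t<n. P (m + t))" for m n :: nat
  using all_less_add[of m n "\<lambda>t. \<not> P t"] by blast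

lemma mat_prod_vec_assoc:
  "(\<Sum>k<m. mat_prod n A B s k * v k) = (\<Sum>l<n. A s l * (\<Sum>k<m. B l k * v k))"
  using mat_prod_assoc[of m n A B "\<lambda>k _. v k" s 0] by (simp add: mat_prod_def)

text \<open>
  With \<open>g = u h\<close> there is an exact sequence \<open>0 \<rightarrow> S/(I : g) \<rightarrow> S/I \<rightarrow> S/(I + (g)) \<rightarrow> 0\<close> whose first map is
  multiplication by \<open>g\<close>, and the cone over a lift of this map resolves the cokernel. The assumption \<open>h P \<subseteq> I\<close>
  allows the lift to be \<open>u \<Gamma>\<close> with \<open>\<Gamma>\<close> lifting multiplication by \<open>h\<close>; as \<open>u\<close> has no constant term, neither has \<open>u \<Gamma>\<close>, and the
  cone is minimal. A lift of \<open>g\<close> that does not factor in this way may contain units.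
\<close>

lemma mapping_cone_resolution:
  fixes I P J :: "('n::finite, 'k::field) mpolynomial set"
  assumes I: "augmented_resolution I r a D" and P: "augmented_resolution P rP aP DP"
    and colon: "\<And>q. q * (u * h) \<in> I \<Longrightarrow> q \<in> P"
    and hP: "\<And>q. q \<in> P \<Longrightarrow> h * q \<in> I"
    and P_proper: "\<And>q. q \<in> P \<Longrightarrow> lookup q 0 = 0"
    and u: "homogeneous_of_degree \<mu> u" "lookup u 0 = 0" and h: "homogeneous_of_degree \<eta> h"
    and J: "\<And>p. p \<in> J \<longleftrightarrow> (\<exists>q. p - q * (u * h) \<in> I)"
  obtains D' where "augmented_resolution J (\<lambda>i. r i + case_nat 0 rP i)
     (\<lambda>i t. if t < r i then a i t else case_nat (\<lambda>_. 0) (\<lambda>i t. aP i t + (\<mu> + \<eta>)) i (t - r i)) D'"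
proof -
  obtain \<Gamma> where \<Gamma>0: "\<Gamma> 0 0 0 = h"
    and \<Gamma>: "\<And>i s t. s < r i \<Longrightarrow> t < rP (Suc i) \<Longrightarrow>
           mat_prod (r (Suc i)) (D i) (\<Gamma> (Suc i)) s t = mat_prod (rP i) (\<Gamma> i) (DP i) s t"
    and \<Gamma>_deg: "\<And>i s t m. s < r i \<Longrightarrow> t < rP i \<Longrightarrow> m \<in> keys (\<Gamma> i s t) \<Longrightarrow>
           exponent_degree m + a i s = aP i t + \<eta>"
    by (rule comparison_chain_map[OF P I h]) (use hP in auto)
  \<comment> \<open>The alternating sign makes the two composites through the cone cancel.\<close>
  define U where "U i = (if even i then u else - u)" for i :: nat
  define B where "B i s t = U i * \<Gamma> i s t" for i s t
  \<comment> \<open>Term \<open>i\<close> of the cone is term \<open>i\<close> for \<open>I\<close> plus term \<open>i - 1\<close> for \<open>P\<close>; the latter is \<open>0\<close> for \<open>i = 0\<close>.\<close>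
  define kk where "kk = case_nat 0 rP"
  define DK where "DK = case_nat (\<lambda>_ _. 0) DP"
  define aK where "aK = case_nat (\<lambda>_. 0) (\<lambda>i t. aP i t + (\<mu> + \<eta>))"
  define D' where "D' i s t =
      (if t < r (Suc i) then (if s < r i then D i s t else 0)
       else if s < r i then B i s (t - r (Suc i)) else DK i (s - r i) (t - r (Suc i)))" for i s t
  have kk_simps [simp]: "kk 0 = 0" "kk (Suc i) = rP i" for i by (simp_all add: kk_def)
  have DK_simps [simp]: "DK (Suc i) = DP i" for i by (simp add: DK_def)
  have aK_simps [simp]: "aK (Suc i) = (\<lambda>t. aP i t + (\<mu> + \<eta>))" for i by (simp add: aK_def)

  have B_comm: "mat_prod (r (Suc i)) (D i) (B (Suc i)) s k = - mat_prod (rP i) (B i) (DP i) s k"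
    if "s < r i" "k < rP (Suc i)" for i s k
  proof -
    have "mat_prod (r (Suc i)) (D i) (B (Suc i)) s k = U (Suc i) * mat_prod (r (Suc i)) (D i) (\<Gamma> (Suc i)) s k"
      by (simp add: mat_prod_def B_def sum_distrib_left mult_ac)
    also have "\<dots> = - U i * mat_prod (rP i) (\<Gamma> i) (DP i) s k"
      by (simp add: \<Gamma> that U_def)
    also have "\<dots> = - mat_prod (rP i) (B i) (DP i) s k"
      by (simp add: mat_prod_def B_def sum_distrib_left mult_ac sum_negf)
    finally show ?thesis .
  qed
  have B_comm_vec: "(\<Sum>t<r (Suc i). D i s t * (\<Sum>k<rP (Suc i). B (Suc i) t k * w k)) =
      - (\<Sum>t<rP i. B i s t * (\<Sum>k<rP (Suc i). DP i t k * w k))" if "s < r i" for i s w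
    unfolding mat_prod_vec_assoc[symmetric] by (simp add: B_comm that sum_negf)

  have rows: "(\<forall>s<r i + kk i. (\<Sum>t<r (Suc i) + kk (Suc i). D' i s t * v t) = z s) \<longleftrightarrow>
      (\<forall>s<r i. (\<Sum>t<r (Suc i). D i s t * v t) + (\<Sum>t<rP i. B i s t * v (r (Suc i) + t)) = z s) \<and>
      (\<forall>s<kk i. (\<Sum>t<rP i. DK i s t * v (r (Suc i) + t)) = z (r i + s))" for i v z
    by (simp add: all_less_add sum_lessThan_add D'_def)

  have exact: "(\<forall>s<r i + kk i. (\<Sum>t<r (Suc i) + kk (Suc i). D' i s t * v t) = 0) \<longleftrightarrow>
      (\<exists>w. \<forall>t<r (Suc i) + kk (Suc i). v t = (\<Sum>k<r (Suc (Suc i)) + kk (Suc (Suc i)). D' (Suc i) t k * w k))"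
    (is "?L \<longleftrightarrow> ?R") for i v
  proof
    let ?q = "\<lambda>t. v (r (Suc i) + t)"
    assume ?L
    then have p: "\<And>s. s < r i \<Longrightarrow> (\<Sum>t<r (Suc i). D i s t * v t) + (\<Sum>t<rP i. B i s t * ?q t) = 0"
      and q: "\<And>s. s < kk i \<Longrightarrow> (\<Sum>t<rP i. DK i s t * ?q t) = 0"
      unfolding rows by auto
    \<comment> \<open>The \<open>P\<close>-part of a cycle is a boundary: by the colon condition at the start, by exactness afterwards.\<close>
    have "\<exists>w. \<forall>t<rP i. ?q t = (\<Sum>k<rP (Suc i). DP i t k * w k)"
    proof (cases i)
      case 0
      have "?q 0 * (u * h) = - (\<Sum>t<r (Suc 0). D 0 0 t * v t)"
        using p[of 0] by (simp add: 0 resolution_rank_0[OF I] resolution_rank_0[OF P] B_def U_def \<Gamma>0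
            eq_neg_iff_add_eq_0 mult_ac add.commute)
      also have "\<dots> = (\<Sum>t<r (Suc 0). D 0 0 t * (- v t))" by (simp add: sum_negf)
      finally have "?q 0 * (u * h) \<in> I"
        unfolding resolution_ideal_iff[OF I] by (rule exI[of _ "\<lambda>t. - v t"])
      then have "?q 0 \<in> P" by (rule colon)
      then show ?thesis
        by (simp add: 0 resolution_ideal_iff[OF P] resolution_rank_0[OF P])
    next
      case (Suc j)
      then show ?thesis using q by (intro resolution_exact[OF P, of j, folded Suc]) simp
    qed
    then obtain w where w: "\<And>t. t < rP i \<Longrightarrow> ?q t = (\<Sum>k<rP (Suc i). DP i t k * w k)" by blast
    have "\<exists>w'. \<forall>t<r (Suc i). v t - (\<Sum>k<rP (Suc i). B (Suc i) t k * w k) =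
        (\<Sum>k<r (Suc (Suc i)). D (Suc i) t k * w' k)"
      using p by (intro resolution_exact[OF I])
        (simp add: right_diff_distrib sum_subtractf B_comm_vec w)
    then obtain w' where w': "\<And>t. t < r (Suc i) \<Longrightarrow> v t - (\<Sum>k<rP (Suc i). B (Suc i) t k * w k) =
        (\<Sum>k<r (Suc (Suc i)). D (Suc i) t k * w' k)" by blast
    define w'' where "w'' t = (if t < r (Suc (Suc i)) then w' t else w (t - r (Suc (Suc i))))" for t
    have "\<forall>t<r (Suc i) + kk (Suc i). (\<Sum>k<r (Suc (Suc i)) + kk (Suc (Suc i)). D' (Suc i) t k * w'' k) = v t"
      unfolding rows by (simp add: w''_def w w'[symmetric])
    then show ?R by (intro exI[of _ w'']) simp
  next
    assume ?R
    then obtain w where "\<forall>t<r (Suc i) + kk (Suc i). (\<Sum>k<r (Suc (Suc i)) + kk (Suc (Suc i)). D' (Suc i) t k * w k) = v t"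
      by metis
    then have p: "\<And>t. t < r (Suc i) \<Longrightarrow> v t = (\<Sum>k<r (Suc (Suc i)). D (Suc i) t k * w k) +
          (\<Sum>k<rP (Suc i). B (Suc i) t k * w (r (Suc (Suc i)) + k))"
      and q: "\<And>t. t < rP i \<Longrightarrow> v (r (Suc i) + t) = (\<Sum>k<rP (Suc i). DP i t k * w (r (Suc (Suc i)) + k))"
      unfolding rows by simp_all
    have "(\<Sum>t<rP i. DK i s t * v (r (Suc i) + t)) = 0" if "s < kk i" for s
    proof (cases i)
      case (Suc j)
      then show ?thesis
        using that resolution_complex_apply[OF P, of s j] by (simp add: Suc q[unfolded Suc])
    qed (use that in simp)
    then show ?L
      unfolding rows
      by (simp add: p q distrib_left sum.distrib resolution_complex_apply[OF I] B_comm_vec)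
  qed

  have "augmented_resolution J (\<lambda>i. r i + kk i) (\<lambda>i t. if t < r i then a i t else aK i (t - r i)) D'"
    unfolding augmented_resolution_def
  proof (intro conjI allI impI ballI)
    show "r 0 + kk 0 = 1" "(if 0 < r 0 then a 0 0 else aK 0 (0 - r 0)) = 0"
      by (simp_all add: resolution_rank_0[OF I] resolution_shift_0[OF I])
  next
    fix i s t m assume s: "s < r i + kk i" and t: "t < r (Suc i) + kk (Suc i)" and m: "m \<in> keys (D' i s t)"
    consider "s < r i" "t < r (Suc i)" | "s < r i" "r (Suc i) \<le> t" | "r i \<le> s" "r (Suc i) \<le> t"
      using m by (cases "s < r i"; cases "t < r (Suc i)") (auto simp: D'_def)
    then show "exponent_degree m + (if s < r i then a i s else aK i (s - r i)) =
         (if t < r (Suc i) then a (Suc i) t else aK (Suc i) (t - r (Suc i)))"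
    proof cases
      case 1
      then show ?thesis using m resolution_graded[OF I] by (simp add: D'_def)
    next
      case 2
      then have "m \<in> keys (U i * \<Gamma> i s (t - r (Suc i)))" using m by (simp add: D'_def B_def)
      then obtain l l' where l: "l \<in> keys (U i)" "l' \<in> keys (\<Gamma> i s (t - r (Suc i)))" "m = l + l'"
        using keys_mult[of "U i" "\<Gamma> i s (t - r (Suc i))"] by blast
      have "exponent_degree l = \<mu>"
        using l(1) u(1) by (auto simp: U_def homogeneous_of_degree_def keys_uminus_poly split: if_splits)
      moreover have "exponent_degree l' + a i s = aP i (t - r (Suc i)) + \<eta>"
        using \<Gamma>_deg[OF _ _ l(2)] 2 t by simp
      ultimately show ?thesis using 2 l(3) by (simp add: exponent_degree_add)
    next
      case 3
      then obtain j where j: "i = Suc j" using s by (cases i) auto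
      have "exponent_degree m + aP j (s - r i) = aP (Suc j) (t - r (Suc i))"
        using 3 s t m by (intro resolution_graded[OF P]) (auto simp: D'_def j)
      then show ?thesis using 3 by (simp add: j)
    qed
  next
    fix p
    have sum: "(\<Sum>t<r 1 + kk 1. D' 0 0 t * v t) = (\<Sum>t<r (Suc 0). D 0 0 t * v t) + v (r (Suc 0)) * (u * h)" for v
      by (simp add: sum_lessThan_add D'_def resolution_rank_0[OF I] resolution_rank_0[OF P] B_def U_def \<Gamma>0 mult_ac)
    show "p \<in> J \<longleftrightarrow> (\<exists>v. p = (\<Sum>t<r 1 + kk 1. D' 0 0 t * v t))"
    proof
      assume "p \<in> J"
      then obtain q v where "p - q * (u * h) = (\<Sum>t<r (Suc 0). D 0 0 t * v t)"
        unfolding J resolution_ideal_iff[OF I] by blast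
      then have "p = (\<Sum>t<r 1 + kk 1. D' 0 0 t * (if t < r (Suc 0) then v t else q))"
        unfolding sum by (simp add: algebra_simps)
      then show "\<exists>v. p = (\<Sum>t<r 1 + kk 1. D' 0 0 t * v t)"
        by (rule exI[of _ "\<lambda>t. if t < r (Suc 0) then v t else q"])
    next
      assume "\<exists>v. p = (\<Sum>t<r 1 + kk 1. D' 0 0 t * v t)"
      then obtain v where "p = (\<Sum>t<r (Suc 0). D 0 0 t * v t) + v (r (Suc 0)) * (u * h)"
        unfolding sum by blast
      then have "p - v (r (Suc 0)) * (u * h) = (\<Sum>t<r (Suc 0). D 0 0 t * v t)" by simp
      then show "p \<in> J" unfolding J resolution_ideal_iff[OF I] by blast
    qed
  next
    fix i v show "(\<forall>s<r i + kk i. (\<Sum>t<r (Suc i) + kk (Suc i). D' i s t * v t) = 0) \<longleftrightarrow>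
      (\<exists>w. \<forall>t<r (Suc i) + kk (Suc i). v t = (\<Sum>k<r (Suc (Suc i)) + kk (Suc (Suc i)). D' (Suc i) t k * w k))"
      by (rule exact)
  next
    fix i s t assume s: "s < r (Suc i) + kk (Suc i)" and t: "t < r (Suc (Suc i)) + kk (Suc (Suc i))"
    have "lookup (DP i s' t') 0 = 0" if "s' < rP i" "t' < rP (Suc i)" for s' t'
    proof (cases i)
      case 0
      then show ?thesis using that resolution_generator_in_ideal[OF P] P_proper
        by (simp add: resolution_rank_0[OF P])
    next
      case (Suc j)
      then show ?thesis using that by (simp add: resolution_minimal[OF P])
    qed
    moreover have "lookup (B (Suc i) s t') 0 = 0" for t'
      by (simp add: B_def const_coeff_mult U_def u(2))
    ultimately show "lookup (D' (Suc i) s t) 0 = 0"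
      using s t by (auto simp: D'_def resolution_minimal[OF I])
  qed
  then show thesis by (rule that[unfolded kk_def[symmetric] aK_def[symmetric]])
qed

section \<open>Linear resolutions of ideals generated by variables\<close>

definition variable_ideal :: "'n::finite set \<Rightarrow> ('n, 'k::comm_ring_1) mpolynomial set" where
  "variable_ideal T = circuit_ideal ((\<lambda>v. {v}) ` T)"

lemma variable_ideal_iff: "p \<in> variable_ideal T \<longleftrightarrow> (\<forall>m\<in>keys p. keys m \<inter> T \<noteq> {})"
  by (auto simp: variable_ideal_def circuit_ideal_iff)

lemma variable_ideal_const_coeff: "p \<in> variable_ideal T \<Longrightarrow> lookup p 0 = 0"
  by (force simp: variable_ideal_iff in_keys_iff)

text \<open>
  Adding a variable \<open>x\<close> outside \<open>T\<close>: it is a nonzerodivisor modulo the ideal, so the cone is taken with \<open>P = I\<close>,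
  \<open>u = x\<close> and \<open>h = 1\<close>. The result is the Koszul complex, whose \<open>i\<close>-th term is generated in degree \<open>i\<close>.
\<close>

lemma variable_ideal_linear_resolution:
  fixes T :: "'n::finite set"
  shows "\<exists>r a D. augmented_resolution (variable_ideal T :: ('n, 'k::field) mpolynomial set) r a D
     \<and> (\<forall>i. \<forall>t<r i. a i t = i)"
proof (induction T rule: finite_induct[OF finite])
  case 1
  have "augmented_resolution (variable_ideal {} :: ('n, 'k) mpolynomial set) (case_nat 1 (\<lambda>_. 0)) (\<lambda>i _. i) (\<lambda>_ _ _. 0)"
    by (auto simp: augmented_resolution_def variable_ideal_iff)
  then show ?case by (metis (no_types))
next
  case (2 x T)
  then obtain r a D where res: "augmented_resolution (variable_ideal T :: ('n, 'k) mpolynomial set) r a D"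
    and lin: "\<And>i t. t < r i \<Longrightarrow> a i t = i" by blast
  obtain D' where "augmented_resolution (variable_ideal (insert x T) :: ('n, 'k) mpolynomial set)
     (\<lambda>i. r i + case_nat 0 r i)
     (\<lambda>i t. if t < r i then a i t else case_nat (\<lambda>_. 0) (\<lambda>i t. a i t + (card {x} + 0)) i (t - r i)) D'"
  proof (rule mapping_cone_resolution[OF res res])
    show "q \<in> variable_ideal T" if "q * (set_monomial {x} * 1) \<in> variable_ideal T" for q :: "('n, 'k) mpolynomial"
    proof -
      have "(\<lambda>G. G - {x}) ` (\<lambda>v. {v}) ` T = (\<lambda>v. {v}) ` T" using 2(2) by force
      with that show ?thesis by (simp add: variable_ideal_def circuit_ideal_colon)
    qed
    show "p \<in> variable_ideal (insert x T) \<longleftrightarrow> (\<exists>q. p - q * (set_monomial {x} * 1) \<in> variable_ideal T)"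
      for p :: "('n, 'k) mpolynomial"
      by (simp add: variable_ideal_def circuit_ideal_insert_iff)
    show "homogeneous_of_degree 0 (1 :: ('n, 'k) mpolynomial)"
      by (simp add: homogeneous_of_degree_def)
    show "homogeneous_of_degree (card {x}) (set_monomial {x} :: ('n, 'k) mpolynomial)"
      by (rule homogeneous_set_monomial)
  qed (simp_all add: variable_ideal_const_coeff set_monomial_const_coeff)
  moreover have "(if t < r i then a i t else case_nat (\<lambda>_. 0) (\<lambda>i t. a i t + (card {x} + 0)) i (t - r i)) = i"
    if "t < r i + case_nat 0 r i" for i t
    using that lin by (cases i) auto
  ultimately show ?case by blast
qed

section \<open>Existence of resolutions of squarefree monomial ideals\<close>

interpretation poly_vec: module "\<lambda>(p::('n, 'k::field) mpolynomial) (v::nat \<Rightarrow> ('n, 'k) mpolynomial) t. p * v t"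
  by unfold_locales (auto simp: algebra_simps)

interpretation scalar_vec: vector_space "\<lambda>(c::'k::field) (v::nat \<Rightarrow> ('n, 'k) mpolynomial) t. monom 0 c * v t"
  by unfold_locales (auto simp: distrib_left distrib_right single_add mult.assoc[symmetric] mult_single)

text \<open>
  The multigraded free module \<open>\<Oplus> S(-W t)\<close> has a basis element of squarefree multidegree \<open>W t\<close> for each \<open>t < r\<close>.
  Its elements of squarefree multidegree \<open>V\<close> have coordinates determined up to scalars, and these scalars are \<open>c\<close>.
\<close>

definition squarefree_vec ::
  "nat \<Rightarrow> (nat \<Rightarrow> 'n::finite set) \<Rightarrow> 'n set \<Rightarrow> (nat \<Rightarrow> 'k::field) \<Rightarrow> nat \<Rightarrow> ('n, 'k) mpolynomial" where
  "squarefree_vec r W V c t = (if t < r \<and> W t \<subseteq> V then monom (indicator_exponent (V - W t)) (c t) else 0)"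

text \<open>
  The component of \<open>v\<close> in multidegree \<open>\<mu>\<close>, divided by \<open>x^(\<mu> - supp \<mu>)\<close> so that its multidegree becomes the support of
  \<open>\<mu>\<close>. The division is possible because all basis elements have squarefree multidegree.
\<close>

definition squarefree_component ::
  "nat \<Rightarrow> (nat \<Rightarrow> 'n::finite set) \<Rightarrow> ('n \<Rightarrow>\<^sub>0 nat) \<Rightarrow> (nat \<Rightarrow> ('n, 'k::field) mpolynomial) \<Rightarrow> nat \<Rightarrow> ('n, 'k) mpolynomial" where
  "squarefree_component r W \<mu> v = squarefree_vec r W (keys \<mu>) (\<lambda>t. lookup (v t) (\<mu> - indicator_exponent (W t)))"

text \<open>
  Closure under squarefree components says at once that the submodule is multigraded and that it is generated in
  squarefree multidegrees. It is the notion of a squarefree module of Yanagawa, for submodules of free modules.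
\<close>

definition squarefree_submodule ::
  "nat \<Rightarrow> (nat \<Rightarrow> 'n::finite set) \<Rightarrow> (nat \<Rightarrow> ('n, 'k::field) mpolynomial) set \<Rightarrow> bool" where
  "squarefree_submodule r W U \<longleftrightarrow> U \<subseteq> free_module r \<and> poly_vec.subspace U \<and>
     (\<forall>v\<in>U. \<forall>\<mu>. squarefree_component r W \<mu> v \<in> U)"

lemma one_le_lookup: "i \<in> keys \<mu> \<Longrightarrow> Suc 0 \<le> lookup \<mu> i"
  by (simp add: in_keys_iff Suc_le_eq)

lemma exponent_split_support:
  assumes "V \<subseteq> keys \<mu>"
  shows "\<mu> - indicator_exponent (keys \<mu>) + indicator_exponent (keys \<mu> - V) = \<mu> - indicator_exponent V"
  using assms one_le_lookup[of _ \<mu>]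
  by (intro poly_mapping_eqI) (auto simp: lookup_add lookup_minus lookup_indicator_exponent not_in_keys_iff_lookup_eq_zero)

lemma exponent_diff_chain:
  assumes "V \<subseteq> V'" "V' \<subseteq> keys \<mu>"
  shows "indicator_exponent (V' - V) + (\<mu> - indicator_exponent V') = \<mu> - indicator_exponent V"
proof (rule poly_mapping_eqI)
  fix i
  show "lookup (indicator_exponent (V' - V) + (\<mu> - indicator_exponent V')) i = lookup (\<mu> - indicator_exponent V) i"
    using assms one_le_lookup[of i \<mu>]
    by (cases "i \<in> V'") (auto simp: lookup_add lookup_minus lookup_indicator_exponent)
qed

lemma indicator_exponent_chain:
  assumes "V \<subseteq> V'" "V' \<subseteq> V''"
  shows "indicator_exponent (V' - V) + indicator_exponent (V'' - V') = indicator_exponent (V'' - V)"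
  using assms by (intro poly_mapping_eqI) (auto simp: lookup_add lookup_indicator_exponent)

lemma exponent_diff_eq_iff:
  assumes "V \<subseteq> keys \<mu>"
  shows "\<mu> - indicator_exponent V = k \<longleftrightarrow> \<mu> = k + indicator_exponent V"
  using indicator_exponent_add_diff[OF assms] by (auto simp: add.commute)

text \<open>
  A vector is the sum of its multigraded components, each a monomial times a squarefree component; \<open>M\<close> collects the
  multidegrees in which \<open>v\<close> has a nonzero component.
\<close>

lemma squarefree_components_sum:
  fixes v :: "nat \<Rightarrow> ('n::finite, 'k::field) mpolynomial" and W :: "nat \<Rightarrow> 'n set"
  assumes v: "v \<in> free_module r"
  defines "M \<equiv> (\<Union>t<r. (\<lambda>m. m + indicator_exponent (W t)) ` keys (v t))"
  shows "v = (\<Sum>\<mu>\<in>M. (\<lambda>t. monom (\<mu> - indicator_exponent (keys \<mu>)) 1 * squarefree_component r W \<mu> v t))"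
proof
  fix t
  have fin: "finite M" by (simp add: M_def)
  show "v t = (\<Sum>\<mu>\<in>M. (\<lambda>t. monom (\<mu> - indicator_exponent (keys \<mu>)) 1 * squarefree_component r W \<mu> v t)) t"
  proof (cases "t < r")
    case False
    then show ?thesis
      using v by (simp add: sum_fun_apply free_module_def squarefree_component_def squarefree_vec_def)
  next
    case True
    let ?W = "indicator_exponent (W t)"
    have "lookup (v t) k = (\<Sum>\<mu>\<in>M. lookup (monom (\<mu> - indicator_exponent (keys \<mu>)) 1 * squarefree_component r W \<mu> v t) k)" for k
    proof -
      have "lookup (monom (\<mu> - indicator_exponent (keys \<mu>)) 1 * squarefree_component r W \<mu> v t) k
          = (if \<mu> = k + ?W then lookup (v t) k else 0)" for \<mu>
      proof (cases "W t \<subseteq> keys \<mu>")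
        case True
        with \<open>t < r\<close> show ?thesis
          by (auto simp: squarefree_component_def squarefree_vec_def mult_single exponent_split_support
              lookup_single when_def exponent_diff_eq_iff)
      next
        case False
        then show ?thesis
          by (auto simp: squarefree_component_def squarefree_vec_def keys_exponent_add)
      qed
      then have "(\<Sum>\<mu>\<in>M. lookup (monom (\<mu> - indicator_exponent (keys \<mu>)) 1 * squarefree_component r W \<mu> v t) k)
          = (if k + ?W \<in> M then lookup (v t) k else 0)"
        using fin by simp
      also have "k + ?W \<in> M" if "k \<in> keys (v t)"
        using True that unfolding M_def by blast
      then have "(if k + ?W \<in> M then lookup (v t) k else 0) = lookup (v t) k"
        by (auto simp: in_keys_iff)
      finally show ?thesis by simp
    qed
    then show ?thesis
      by (intro poly_mapping_eqI) (simp add: sum_fun_apply lookup_sum)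
  qed
qed

text \<open>
  Kernels of squarefree matrices inherit squarefreeness: up to a monomial factor, the left-hand side is the
  component of multidegree \<open>\<mu>\<close> of \<open>A w\<close>.
\<close>

lemma squarefree_component_kernel:
  fixes w :: "nat \<Rightarrow> ('n::finite, 'k::field) mpolynomial"
  assumes A: "\<And>k. k < r' \<Longrightarrow> A s k = squarefree_vec r W (W' k) (c k) s" and s: "s < r"
    and w: "(\<Sum>k<r'. A s k * w k) = 0"
  shows "(\<Sum>k<r'. A s k * squarefree_component r' W' \<mu> w k) = 0"
proof (cases "W s \<subseteq> keys \<mu>")
  case True
  let ?m = "\<mu> - indicator_exponent (W s)"
  have "A s k * squarefree_component r' W' \<mu> w k =
      monom (indicator_exponent (keys \<mu> - W s)) (lookup (A s k * w k) ?m)" if k: "k < r'" for k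
  proof (cases "W s \<subseteq> W' k")
    case sub: True
    show ?thesis
    proof (cases "W' k \<subseteq> keys \<mu>")
      case True
      then show ?thesis
        using k s sub lookup_monom_mult_add[of "indicator_exponent (W' k - W s)" "c k s" "w k" "\<mu> - indicator_exponent (W' k)"]
        by (simp add: A squarefree_component_def squarefree_vec_def mult_single indicator_exponent_chain exponent_diff_chain)
    next
      case False
      then obtain i where i: "i \<in> W' k" "i \<notin> keys \<mu>" by blast
      have "?m \<noteq> indicator_exponent (W' k - W s) + l" for l
      proof
        assume "?m = indicator_exponent (W' k - W s) + l"
        then have "lookup ?m i = lookup (indicator_exponent (W' k - W s) + l) i" by simp
        moreover have "i \<notin> W s" using i(2) \<open>W s \<subseteq> keys \<mu>\<close> by blast
        ultimately show False
          using i by (simp add: lookup_add lookup_minus lookup_indicator_exponent in_keys_iff)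
      qed
      then show ?thesis
        using False k s sub
        by (simp add: A squarefree_component_def squarefree_vec_def lookup_monom_mult_eq_0)
    qed
  next
    case False
    then show ?thesis using k by (simp add: A squarefree_vec_def)
  qed
  then have "(\<Sum>k<r'. A s k * squarefree_component r' W' \<mu> w k) =
      (\<Sum>k<r'. monom (indicator_exponent (keys \<mu> - W s)) (lookup (A s k * w k) ?m))" by simp
  also have "\<dots> = monom (indicator_exponent (keys \<mu> - W s)) (lookup (\<Sum>k<r'. A s k * w k) ?m)"
    by (rule poly_mapping_eqI) (simp add: lookup_sum lookup_single when_def)
  finally show ?thesis by (simp add: w)
next
  case False
  then have "A s k * squarefree_component r' W' \<mu> w k = 0" if "k < r'" for k
    using that by (auto simp: A squarefree_component_def squarefree_vec_def)
  then show ?thesis by simp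
qed

text \<open>
  A basis, chosen among the given vectors, of the vector space that they span; this space is finite-dimensional because a squarefree
  vector is determined by \<open>r\<close> scalars.
\<close>

lemma squarefree_vecs_finitely_spanned:
  fixes X :: "(nat \<Rightarrow> ('n::finite, 'k::field) mpolynomial) set"
  assumes "X \<subseteq> range (squarefree_vec r W V)"
  obtains B where "finite B" "B \<subseteq> X" "X \<subseteq> poly_vec.span B"
proof -
  let ?E = "(\<lambda>t. squarefree_vec r W V (\<lambda>t'. if t' = t then (1::'k) else 0)) ` {..<r}"
  have X: "X \<subseteq> scalar_vec.span ?E"
  proof
    fix x assume "x \<in> X"
    with assms obtain c where x: "x = squarefree_vec r W V c" by auto
    have "x = (\<Sum>t<r. (\<lambda>t'. monom 0 (c t) * squarefree_vec r W V (\<lambda>t'. if t' = t then 1 else 0) t'))"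
    proof
      fix t'
      have "monom 0 (c t) * squarefree_vec r W V (\<lambda>t'. if t' = t then 1 else 0) t' =
          (if t = t' then squarefree_vec r W V c t' else 0)" for t
        by (simp add: squarefree_vec_def mult_single)
      then show "x t' = (\<Sum>t<r. (\<lambda>t'. monom 0 (c t) * squarefree_vec r W V (\<lambda>t'. if t' = t then 1 else 0) t')) t'"
        by (simp add: sum_fun_apply x) (simp add: squarefree_vec_def)
    qed
    also have "\<dots> \<in> scalar_vec.span ?E"
      by (intro scalar_vec.span_sum scalar_vec.span_scale scalar_vec.span_base) auto
    finally show "x \<in> scalar_vec.span ?E" .
  qed
  obtain B where B: "B \<subseteq> X" "scalar_vec.independent B" "X \<subseteq> scalar_vec.span B"
    by (rule scalar_vec.maximal_independent_subset)
  have "finite B"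
    using scalar_vec.independent_span_bound[of ?E B] B X by blast
  moreover have "scalar_vec.span B \<subseteq> poly_vec.span B"
    by (rule scalar_vec.span_minimal)
       (auto simp: scalar_vec.subspace_def poly_vec.span_superset poly_vec.span_zero
         poly_vec.span_add poly_vec.span_scale)
  ultimately show thesis using that B by blast
qed

text \<open>
  One finite family for each of the finitely many sets \<open>V\<close> yields a finite generating set, and one with
  the least number of elements is irredundant.
\<close>

lemma squarefree_submodule_minimal_generators:
  fixes U :: "(nat \<Rightarrow> ('n::finite, 'k::field) mpolynomial) set"
  assumes "squarefree_submodule r W U"
  obtains B where "finite B" "poly_vec.span B = U"
    and "\<And>b. b \<in> B \<Longrightarrow> \<exists>V c. b = squarefree_vec r W V c"
    and "\<And>b. b \<in> B \<Longrightarrow> b \<notin> poly_vec.span (B - {b})"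
proof -
  have U: "U \<subseteq> free_module r" "poly_vec.subspace U" "\<And>v \<mu>. v \<in> U \<Longrightarrow> squarefree_component r W \<mu> v \<in> U"
    using assms by (auto simp: squarefree_submodule_def)
  define G where "G V = U \<inter> range (squarefree_vec r W V)" for V
  have "\<forall>V. \<exists>B. finite B \<and> B \<subseteq> G V \<and> G V \<subseteq> poly_vec.span B"
    using squarefree_vecs_finitely_spanned[of "G _" r W] unfolding G_def by (metis inf_le2)
  then obtain B0 where B0: "\<And>V. finite (B0 V)" "\<And>V. B0 V \<subseteq> G V" "\<And>V. G V \<subseteq> poly_vec.span (B0 V)"
    by metis
  define P where "P B \<longleftrightarrow> finite B \<and> B \<subseteq> (\<Union>V. G V) \<and> U \<subseteq> poly_vec.span B" for B
  have "P (\<Union>V. B0 V)"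
    unfolding P_def
  proof (intro conjI subsetI)
    fix v assume v: "v \<in> U"
    have "squarefree_component r W \<mu> v \<in> poly_vec.span (\<Union>V. B0 V)" for \<mu>
    proof -
      have "squarefree_component r W \<mu> v \<in> G (keys \<mu>)"
        using U(3)[OF v] by (simp add: G_def squarefree_component_def)
      then show ?thesis
        using B0(3) poly_vec.span_mono[of "B0 (keys \<mu>)" "\<Union>V. B0 V"] by blast
    qed
    then show "v \<in> poly_vec.span (\<Union>V. B0 V)"
      using U(1) v by (subst squarefree_components_sum[of v r W])
        (auto intro!: poly_vec.span_sum poly_vec.span_scale)
  qed (use B0 in auto)
  then obtain B where B: "P B" and least: "\<And>B'. P B' \<Longrightarrow> card B \<le> card B'"
    using ex_has_least_nat[of P _ card] by blast
  show thesis
  proof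
    show "finite B" using B by (simp add: P_def)
    show "poly_vec.span B = U"
      using B U(2) poly_vec.span_minimal[of B U] by (auto simp: P_def G_def)
    fix b assume b: "b \<in> B"
    then have "b \<in> (\<Union>V. G V)" using B by (auto simp: P_def)
    then show "\<exists>V c. b = squarefree_vec r W V c" by (auto simp: G_def)
    show "b \<notin> poly_vec.span (B - {b})"
    proof
      assume "b \<in> poly_vec.span (B - {b})"
      then have "B \<subseteq> poly_vec.span (B - {b})"
        using poly_vec.span_superset[of "B - {b}"] by blast
      then have "poly_vec.span B \<subseteq> poly_vec.span (B - {b})"
        by (rule poly_vec.span_minimal) (rule poly_vec.subspace_span)
      then have "P (B - {b})" using B by (auto simp: P_def)
      from least[OF this] show False
        using B b by (metis P_def card_Diff1_less leD)
    qed
  qed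
qed

definition syzygies :: "nat \<Rightarrow> nat \<Rightarrow> (nat \<Rightarrow> nat \<Rightarrow> 'a::comm_ring_1) \<Rightarrow> (nat \<Rightarrow> 'a) set" where
  "syzygies r r' A = {w \<in> free_module r'. \<forall>s<r. (\<Sum>k<r'. A s k * w k) = 0}"

text \<open>
  One step of a minimal resolution: a homogeneous matrix with image \<open>U\<close> whose syzygies have no constant terms.
  The last condition makes the next differential minimal.
\<close>

definition minimal_cover ::
  "nat \<Rightarrow> (nat \<Rightarrow> 'n::finite set) \<Rightarrow> (nat \<Rightarrow> ('n, 'k::field) mpolynomial) set \<Rightarrow>
   nat \<Rightarrow> (nat \<Rightarrow> 'n set) \<Rightarrow> (nat \<Rightarrow> nat \<Rightarrow> ('n, 'k) mpolynomial) \<Rightarrow> bool" where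
  "minimal_cover r W U r' W' A \<longleftrightarrow>
     (\<forall>s<r. \<forall>t<r'. \<forall>m\<in>keys (A s t). exponent_degree m + card (W s) = card (W' t)) \<and>
     (\<forall>v\<in>free_module r. v \<in> U \<longleftrightarrow> (\<exists>w. \<forall>s<r. v s = (\<Sum>k<r'. A s k * w k))) \<and>
     (\<forall>w. (\<forall>s<r. (\<Sum>k<r'. A s k * w k) = 0) \<longrightarrow> (\<forall>k<r'. lookup (w k) 0 = 0))"

text \<open>
  The columns of \<open>A\<close> are an irredundant system of squarefree generators. If a syzygy had a nonzero constant term
  at a generator, then the component of the syzygy in the multidegree of that generator would express the generator by the others.
\<close>

lemma squarefree_submodule_cover:
  fixes U :: "(nat \<Rightarrow> ('n::finite, 'k::field) mpolynomial) set"
  assumes U: "squarefree_submodule r W U"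
  obtains r' W' A where "minimal_cover r W U r' W' A" "squarefree_submodule r' W' (syzygies r r' A)"
proof -
  obtain B where B: "finite B" "poly_vec.span B = U" "\<And>b. b \<in> B \<Longrightarrow> \<exists>V c. b = squarefree_vec r W V c"
    and irredundant: "\<And>b. b \<in> B \<Longrightarrow> b \<notin> poly_vec.span (B - {b})"
    using squarefree_submodule_minimal_generators[OF U] by metis
  obtain g where g: "bij_betw g {..<card B} B"
    using ex_bij_betw_nat_finite[OF B(1)] by (auto simp: atLeast0LessThan)
  define r' where "r' = card B"
  have "\<forall>k. \<exists>V c. k < r' \<longrightarrow> g k = squarefree_vec r W V c"
    using B(3) g by (metis bij_betwE lessThan_iff r'_def)
  then obtain W' c where W': "\<And>k. k < r' \<Longrightarrow> g k = squarefree_vec r W (W' k) (c k)"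
    by metis
  define A where "A s k = g k s" for s k
  have A: "A s k = squarefree_vec r W (W' k) (c k) s" if "k < r'" for s k
    using W'[OF that] by (simp add: A_def)
  have graded: "exponent_degree m + card (W s) = card (W' t)" if "s < r" "t < r'" "m \<in> keys (A s t)" for s t m
    using that by (auto simp: A squarefree_vec_def exponent_degree_indicator card_Diff_subset card_mono
        split: if_splits)
  have image: "v \<in> U \<longleftrightarrow> (\<exists>w. \<forall>s<r. v s = (\<Sum>k<r'. A s k * w k))" if v: "v \<in> free_module r" for v
  proof -
    have "v \<in> U \<longleftrightarrow> (\<exists>u. v = (\<Sum>b\<in>B. (\<lambda>s. u b * b s)))"
      using poly_vec.span_finite[OF B(1)] B(2) by auto
    also have "\<dots> \<longleftrightarrow> (\<exists>u. \<forall>s<r. v s = (\<Sum>b\<in>B. u b * b s))"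
    proof (intro ex_cong1)
      fix u :: "(nat \<Rightarrow> ('n, 'k) mpolynomial) \<Rightarrow> ('n, 'k) mpolynomial"
      have "v s = (\<Sum>b\<in>B. u b * b s)" if "\<not> s < r" for s
      proof -
        have "u b * b s = 0" if "b \<in> B" for b
          using B(3)[OF that] \<open>\<not> s < r\<close> by (auto simp: squarefree_vec_def)
        then have "(\<Sum>b\<in>B. u b * b s) = 0" by (intro sum.neutral ballI)
        with that v show ?thesis by (simp add: free_module_def)
      qed
      then show "v = (\<Sum>b\<in>B. (\<lambda>s. u b * b s)) \<longleftrightarrow> (\<forall>s<r. v s = (\<Sum>b\<in>B. u b * b s))"
        by (auto simp: fun_eq_iff sum_fun_apply)
    qed
    also have "\<dots> \<longleftrightarrow> (\<exists>u. \<forall>s<r. v s = (\<Sum>k<r'. A s k * u (g k)))"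
      by (simp add: sum.reindex_bij_betw[OF g, symmetric] r'_def A_def mult.commute)
    also have "\<dots> \<longleftrightarrow> (\<exists>w. \<forall>s<r. v s = (\<Sum>k<r'. A s k * w k))"
    proof
      assume "\<exists>w. \<forall>s<r. v s = (\<Sum>k<r'. A s k * w k)"
      then obtain w where "\<forall>s<r. v s = (\<Sum>k<r'. A s k * w k)" by blast
      then have "\<forall>s<r. v s = (\<Sum>k<r'. A s k * (\<lambda>b. w (inv_into {..<r'} g b)) (g k))"
        using g by (simp add: r'_def bij_betw_def inv_into_f_f)
      then show "\<exists>u. \<forall>s<r. v s = (\<Sum>k<r'. A s k * u (g k))"
        by (rule exI[of _ "\<lambda>b. w (inv_into {..<r'} g b)"])
    qed auto
    finally show ?thesis .
  qed
  let ?K = "syzygies r r' A"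
  have comp: "(\<Sum>k<r'. A s k * squarefree_component r' W' \<mu> w k) = 0"
    if "\<forall>s<r. (\<Sum>k<r'. A s k * w k) = 0" "s < r" for w \<mu> s
    using that by (intro squarefree_component_kernel[OF A]) auto
  have "poly_vec.subspace ?K"
  proof (rule poly_vec.subspaceI)
    fix p :: "('n, 'k) mpolynomial" and w assume "w \<in> ?K"
    moreover have "(\<Sum>k<r'. A s k * (p * w k)) = p * (\<Sum>k<r'. A s k * w k)" for s
      by (simp add: sum_distrib_left mult_ac)
    ultimately show "(\<lambda>t. p * w t) \<in> ?K"
      by (simp add: syzygies_def free_module_def)
  qed (auto simp: syzygies_def free_module_def distrib_left sum.distrib)
  moreover have "squarefree_component r' W' \<mu> w \<in> ?K" if "w \<in> ?K" for w \<mu>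
    using that comp by (auto simp: syzygies_def free_module_def squarefree_component_def squarefree_vec_def)
  ultimately have kernel: "squarefree_submodule r' W' ?K"
    by (auto simp: squarefree_submodule_def syzygies_def)
  have minimal: "lookup (w k0) 0 = 0" if w: "\<forall>s<r. (\<Sum>k<r'. A s k * w k) = 0" and k0: "k0 < r'" for w k0
  proof (rule ccontr)
    assume nz: "lookup (w k0) 0 \<noteq> 0"
    define c0 where "c0 = lookup (w k0) 0"
    \<comment> \<open>In this multidegree the coordinate at \<open>k0\<close> is exactly the scalar \<open>c0\<close>, hence invertible.\<close>
    define x where "x = squarefree_component r' W' (indicator_exponent (W' k0)) w"
    have x: "(\<Sum>k<r'. A s k * x k) = 0" for s
    proof (cases "s < r")
      case True
      then show ?thesis using comp[OF w] by (simp add: x_def)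
    qed (simp add: A squarefree_vec_def)
    have xk0: "x k0 = monom 0 c0"
      using k0 by (simp add: x_def squarefree_component_def squarefree_vec_def c0_def)
    have "g k0 s = (\<Sum>k\<in>{..<r'} - {k0}. - (monom 0 (1 / c0) * x k) * g k s)" for s
    proof -
      have "monom 0 c0 * g k0 s + (\<Sum>k\<in>{..<r'} - {k0}. x k * g k s) = 0"
        using x[of s] k0 by (simp add: sum.remove[of _ k0] A_def xk0 mult.commute)
      then have "monom 0 (1 / c0) * (monom 0 c0 * g k0 s) = - (monom 0 (1 / c0) * (\<Sum>k\<in>{..<r'} - {k0}. x k * g k s))"
        by (simp add: eq_neg_iff_add_eq_0 flip: distrib_left)
      moreover have "monom 0 (1 / c0) * (monom 0 c0 * g k0 s) = g k0 s"
        using nz by (simp add: mult.assoc[symmetric] mult_single c0_def)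
      ultimately show ?thesis
        by (simp add: sum_distrib_left sum_negf mult.assoc)
    qed
    then have "g k0 = (\<Sum>k\<in>{..<r'} - {k0}. (\<lambda>s. - (monom 0 (1 / c0) * x k) * g k s))"
      by (simp add: fun_eq_iff sum_fun_apply)
    also have "\<dots> \<in> poly_vec.span (B - {g k0})"
    proof (intro poly_vec.span_sum poly_vec.span_scale poly_vec.span_base)
      fix k assume "k \<in> {..<r'} - {k0}"
      then show "g k \<in> B - {g k0}"
        using g k0 by (auto simp: bij_betw_def r'_def inj_on_def)
    qed
    finally show False
      using irredundant g k0 by (auto simp: bij_betw_def r'_def)
  qed
  have "minimal_cover r W U r' W' A"
    unfolding minimal_cover_def using graded image minimal by blast
  then show thesis using kernel by (rule that)
qed

text \<open>
  Covers are iterated, each covering the syzygies of the one before it; the start is the ideal itself as a squarefree submodule of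
  \<open>S\<close>, whose basis element has multidegree \<open>{}\<close>.
\<close>

theorem squarefree_ideal_has_resolution:
  fixes \<D> :: "'n::finite set set"
  obtains r a D where "augmented_resolution (circuit_ideal \<D> :: ('n, 'k::field) mpolynomial set) r a D"
proof -
  let ?I = "circuit_ideal \<D> :: ('n, 'k) mpolynomial set"
  define good where "good = (\<lambda>(r, W, U :: (nat \<Rightarrow> ('n, 'k) mpolynomial) set). squarefree_submodule r W U)"
  define cover where "cover = (\<lambda>(r, W, U :: (nat \<Rightarrow> ('n, 'k) mpolynomial) set) (r', W', U') A.
     minimal_cover r W U r' W' A \<and> U' = syzygies r r' A)"
  define U0 where "U0 = {v \<in> free_module 1. v 0 \<in> ?I}"
  have "\<exists>f. \<forall>i. (good (f i) \<and> (i = 0 \<longrightarrow> f i = (1, \<lambda>_. {}, U0)))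
      \<and> (\<exists>A. cover (f i) (f (Suc i)) A)"
  proof (rule dependent_nat_choice)
    have "squarefree_submodule 1 (\<lambda>_. {}) U0"
      unfolding squarefree_submodule_def
    proof (intro conjI ballI allI)
      have "p * q \<in> ?I" if "q \<in> ?I" for p q
        using that unfolding circuit_ideal_def ideal_generated_by_def
        by (rule module.span_scale[OF module_times])
      moreover have "p + q \<in> ?I" if "p \<in> ?I" "q \<in> ?I" for p q
        using that unfolding circuit_ideal_def ideal_generated_by_def
        by (rule module.span_add[OF module_times])
      ultimately show "poly_vec.subspace U0"
        by (auto simp: poly_vec.subspace_def U0_def free_module_def circuit_ideal_iff[of 0])
      fix v \<mu> assume "v \<in> U0"
      then show "squarefree_component 1 (\<lambda>_. {}) \<mu> v \<in> U0"
        by (auto simp: U0_def free_module_def squarefree_component_def squarefree_vec_def circuit_ideal_iff in_keys_iff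
            split: if_splits)
    qed (auto simp: U0_def)
    then show "\<exists>x. good x \<and> (0 = 0 \<longrightarrow> x = (1, \<lambda>_. {}, U0))"
      by (simp add: good_def)
  next
    fix x :: "nat \<times> (nat \<Rightarrow> 'n set) \<times> (nat \<Rightarrow> ('n, 'k) mpolynomial) set" and i :: nat
    obtain r W U where x: "x = (r, W, U)" by (cases x)
    assume "good x \<and> (i = 0 \<longrightarrow> x = (1, \<lambda>_. {}, U0))"
    then have "squarefree_submodule r W U" by (simp add: x good_def)
    then obtain r' W' A where "minimal_cover r W U r' W' A" "squarefree_submodule r' W' (syzygies r r' A)"
      by (rule squarefree_submodule_cover)
    then show "\<exists>y. (good y \<and> (Suc i = 0 \<longrightarrow> y = (1, \<lambda>_. {}, U0))) \<and> (\<exists>A. cover x y A)"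
      by (intro exI[of _ "(r', W', syzygies r r' A)"]) (auto simp: good_def cover_def x)
  qed
  then obtain f D where f0: "f 0 = (1, \<lambda>_. {}, U0)" and cov: "\<And>i. cover (f i) (f (Suc i)) (D i)"
    by metis
  define r W U where "r i = fst (f i)" and "W i = fst (snd (f i))" and "U i = snd (snd (f i))" for i
  have f: "f i = (r i, W i, U i)" for i by (simp add: r_def W_def U_def)
  have init: "r 0 = 1" "W 0 0 = {}" "U 0 = U0" using f0 by (simp_all add: f)
  have graded: "\<And>s t m. s < r i \<Longrightarrow> t < r (Suc i) \<Longrightarrow> m \<in> keys (D i s t) \<Longrightarrow> exponent_degree m + card (W i s) = card (W (Suc i) t)"
    and image: "\<And>v. v \<in> free_module (r i) \<Longrightarrow> v \<in> U i \<longleftrightarrow> (\<exists>w. \<forall>s<r i. v s = (\<Sum>k<r (Suc i). D i s k * w k))"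
    and kernel: "U (Suc i) = {w \<in> free_module (r (Suc i)). \<forall>s<r i. (\<Sum>k<r (Suc i). D i s k * w k) = 0}"
    and minimal: "\<And>w k. (\<forall>s<r i. (\<Sum>k<r (Suc i). D i s k * w k) = 0) \<Longrightarrow> k < r (Suc i) \<Longrightarrow> lookup (w k) 0 = 0" for i
    using cov[of i] unfolding cover_def f prod.case minimal_cover_def syzygies_def by blast+
  have exact: "(\<forall>s<r i. (\<Sum>t<r (Suc i). D i s t * v t) = 0) \<longleftrightarrow>
            (\<exists>w. \<forall>t<r (Suc i). v t = (\<Sum>k<r (Suc (Suc i)). D (Suc i) t k * w k))" for i v
  proof -
    let ?v = "\<lambda>t. if t < r (Suc i) then v t else 0"
    have "(\<forall>s<r i. (\<Sum>t<r (Suc i). D i s t * v t) = 0) \<longleftrightarrow> ?v \<in> U (Suc i)"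
      by (simp add: kernel free_module_trunc)
    also have "\<dots> \<longleftrightarrow> (\<exists>w. \<forall>t<r (Suc i). v t = (\<Sum>k<r (Suc (Suc i)). D (Suc i) t k * w k))"
      by (subst image) (simp_all add: free_module_trunc)
    finally show ?thesis .
  qed
  have "augmented_resolution ?I r (\<lambda>i t. card (W i t)) D"
    unfolding augmented_resolution_def
  proof (intro conjI allI impI ballI)
    show "p \<in> ?I \<longleftrightarrow> (\<exists>v. p = (\<Sum>t<r 1. D 0 0 t * v t))" for p
    proof -
      let ?v = "\<lambda>t. if t < 1 then p else (0 :: ('n, 'k) mpolynomial)"
      have "p \<in> ?I \<longleftrightarrow> ?v \<in> U 0" by (simp add: init U0_def free_module_def)
      also have "\<dots> \<longleftrightarrow> (\<exists>v. p = (\<Sum>t<r 1. D 0 0 t * v t))"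
        by (subst image) (simp_all add: init free_module_def)
      finally show ?thesis .
    qed
    fix i s t assume "s < r (Suc i)" "t < r (Suc (Suc i))"
    then have "\<exists>w. \<forall>t'<r (Suc i). D (Suc i) t' t = (\<Sum>k<r (Suc (Suc i)). D (Suc i) t' k * w k)"
      by (intro exI[of _ "\<lambda>k. if k = t then 1 else 0"])
         (simp add: if_distrib[of "\<lambda>x. _ * x"] cong: if_cong)
    then show "lookup (D (Suc i) s t) 0 = 0"
      using minimal[of i "\<lambda>s. D (Suc i) s t" s] \<open>s < r (Suc i)\<close> exact[of i "\<lambda>s. D (Suc i) s t"] by blast
  qed (use init graded exact in simp_all)
  then show thesis by (rule that)
qed

section \<open>Regularity after removing a circuit\<close>

text \<open>
  Expand a generator \<open>x\<^sub>G\<close> through the first differential. Some contributing entry has a monomial that divides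
  \<open>x\<^sub>G\<close>, so the degree of that entry is at most \<open>d\<close>; but the entry lies in the ideal, all of whose monomials have degree at least \<open>d\<close>.
\<close>

lemma circuit_ideal_initial_generator:
  fixes I :: "('n::finite, 'k::field) mpolynomial set"
  assumes res: "augmented_resolution (circuit_ideal \<D> :: ('n, 'k) mpolynomial set) r a D"
    and \<D>: "\<And>G. G \<in> \<D> \<Longrightarrow> card G = d" and G: "G \<in> \<D>"
  shows "\<exists>t<r (Suc 0). a (Suc 0) t = d"
proof -
  have "(set_monomial G :: ('n, 'k) mpolynomial) \<in> circuit_ideal \<D>"
    using G by (auto simp: circuit_ideal_iff set_monomial_eq_monom)
  then obtain v where v: "set_monomial G = (\<Sum>t<r (Suc 0). D 0 0 t * v t)"
    using resolution_ideal_iff[OF res] by blast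
  have "indicator_exponent G \<in> keys (set_monomial G :: ('n, 'k) mpolynomial)"
    by (simp add: set_monomial_eq_monom)
  then obtain t where t: "t < r (Suc 0)" "indicator_exponent G \<in> keys (D 0 0 t * v t)"
    unfolding v using keys_sum[of "\<lambda>t. D 0 0 t * v t" "{..<r (Suc 0)}"] by blast
  then obtain l l' where l: "l \<in> keys (D 0 0 t)" "indicator_exponent G = l + l'"
    using keys_mult[of "D 0 0 t" "v t"] by blast
  obtain G' where G': "G' \<in> \<D>" "G' \<subseteq> keys l"
    using resolution_generator_in_ideal[OF res t(1)] l(1) unfolding circuit_ideal_iff by blast
  have "d = card G'" using \<D> G' by simp
  also have "\<dots> \<le> exponent_degree l"
    using indicator_exponent_add_diff[OF G'(2)] by (metis exponent_degree_add exponent_degree_indicator le_add1)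
  finally have "d \<le> exponent_degree l" .
  moreover have "exponent_degree l \<le> d"
    using l(2) \<D>[OF G] by (metis exponent_degree_add exponent_degree_indicator le_add1)
  moreover have "exponent_degree l = a (Suc 0) t"
    using resolution_graded[OF res _ t(1) l(1)] by (simp add: resolution_rank_0[OF res] resolution_shift_0[OF res])
  ultimately show ?thesis using t(1) by auto
qed

theorem corollary3p8:
  fixes d :: nat
    and \<C> :: "'n::finite set set"
    and e F :: "'n set"
    and I :: "('n, 'k::field) mpolynomial set"
  assumes "0 < d" and "d \<le> CARD('n)"
    and "uniform_clutter d \<C>" and "\<C> \<noteq> full_clutter d"
    and "I = circuit_ideal (clutter_complement d \<C>)"
    and "submaximal_circuit d \<C> e"
    and "F \<in> \<C>" and "e \<subset> F" and "\<forall>G\<in>\<C>. e \<subset> G \<longrightarrow> G = F"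
  shows "cm_regularity I = cm_regularity (I + ideal_generated_by {set_monomial F})"
proof -
  let ?\<D> = "clutter_complement d \<C>"
  have \<D>: "G \<in> ?\<D> \<longleftrightarrow> card G = d \<and> G \<notin> \<C>" for G
    by (simp add: clutter_complement_def full_clutter_def)
  have card_F: "card F = d" and card_e: "card e = d - 1"
    using assms(3,6,7) by (auto simp: uniform_clutter_def full_clutter_def submaximal_circuit_def)
  have "card (F - e) = 1"
    using assms(1,8) card_F card_e by (subst card_Diff_subset) auto
  then obtain x where x: "F - e = {x}" by (auto simp: card_1_singleton_iff)
  have F: "F = insert x e" "x \<notin> e" using x assms(8) by auto
  have x_F: "(set_monomial F :: ('n, 'k) mpolynomial) = set_monomial {x} * set_monomial e"
    using F by (simp add: set_monomial_def)

  obtain r a D where res: "augmented_resolution I r a D"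
    using squarefree_ideal_has_resolution[of ?\<D>] assms(5) by metis
  obtain rP aP DP where resP: "augmented_resolution (variable_ideal (- F) :: ('n, 'k) mpolynomial set) rP aP DP"
    and lin: "\<And>i t. t < rP i \<Longrightarrow> aP i t = i"
    using variable_ideal_linear_resolution[of "- F"] by metis
  let ?J = "I + ideal_generated_by {set_monomial F}"
  obtain D' where resJ: "augmented_resolution ?J (\<lambda>i. r i + case_nat 0 rP i)
     (\<lambda>i t. if t < r i then a i t else case_nat (\<lambda>_. 0) (\<lambda>i t. aP i t + (card {x} + card e)) i (t - r i)) D'"
  proof (rule mapping_cone_resolution[OF res resP])
    fix q :: "('n, 'k) mpolynomial"
    assume "q * (set_monomial {x} * set_monomial e) \<in> I"
    then have "q \<in> circuit_ideal ((\<lambda>G. G - F) ` ?\<D>)"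
      by (simp add: assms(5) circuit_ideal_colon flip: x_F)
    moreover have "\<not> G \<subseteq> F" if "G \<in> ?\<D>" for G
      using that assms(7) card_F by (metis \<D> card_subset_eq finite)
    ultimately show "q \<in> variable_ideal (- F)"
      by (fastforce simp: variable_ideal_iff circuit_ideal_iff)
  next
    fix q :: "('n, 'k) mpolynomial"
    assume q: "q \<in> variable_ideal (- F)"
    have "q \<in> circuit_ideal ((\<lambda>G. G - e) ` ?\<D>)"
      unfolding circuit_ideal_iff
    proof
      fix m assume "m \<in> keys q"
      then obtain v where v: "v \<in> keys m" "v \<notin> F"
        using q by (auto simp: variable_ideal_iff)
      then have "insert v e \<in> ?\<D>"
        using F assms(1,9) card_e by (auto simp: \<D>)
      moreover have "insert v e - e \<subseteq> keys m" using v(1) by blast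
      ultimately show "\<exists>G\<in>(\<lambda>G. G - e) ` ?\<D>. G \<subseteq> keys m" by (rule bexI[OF _ imageI, rotated])
    qed
    then show "set_monomial e * q \<in> I"
      by (simp add: assms(5) circuit_ideal_colon mult.commute[of "set_monomial e"])
  next
    fix p :: "('n, 'k) mpolynomial"
    show "p \<in> ?J \<longleftrightarrow> (\<exists>q. p - q * (set_monomial {x} * set_monomial e) \<in> I)"
      by (simp add: assms(5) circuit_ideal_plus circuit_ideal_insert_iff flip: x_F)
  qed (rule variable_ideal_const_coeff homogeneous_set_monomial set_monomial_const_coeff insert_not_empty | assumption)+

  have nonzero_I: "graded_betti I i j \<noteq> 0 \<longleftrightarrow> (\<exists>t<r (Suc i). a (Suc i) t = j)" for i j
    by (auto simp: graded_betti_eq_card[OF res])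
  have nonzero_J: "graded_betti ?J i j \<noteq> 0 \<longleftrightarrow> graded_betti I i j \<noteq> 0 \<or> j = i + d \<and> rP i \<noteq> 0" for i j
  proof -
    have "graded_betti ?J i j \<noteq> 0 \<longleftrightarrow> (\<exists>t<r (Suc i) + rP i.
        (if t < r (Suc i) then a (Suc i) t else aP i (t - r (Suc i)) + (card {x} + card e)) = j)"
      by (auto simp: graded_betti_eq_card[OF resJ])
    also have "\<dots> \<longleftrightarrow> (\<exists>t<r (Suc i). a (Suc i) t = j) \<or> (\<exists>t<rP i. aP i t + (card {x} + card e) = j)"
      unfolding ex_less_add by (simp cong: conj_cong)
    also have "(\<exists>t<rP i. aP i t + (card {x} + card e) = j) \<longleftrightarrow> j = i + d \<and> rP i \<noteq> 0"
      using assms(1) card_e lin[of _ i] by (auto intro: exI[of _ 0])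
    finally show ?thesis unfolding nonzero_I .
  qed
  obtain G where "G \<in> ?\<D>"
    using assms(3,4) by (auto simp: \<D> uniform_clutter_def full_clutter_def)
  have "\<exists>t<r (Suc 0). a (Suc 0) t = d"
    by (rule circuit_ideal_initial_generator[OF _ _ \<open>G \<in> ?\<D>\<close>])
       (use res in \<open>simp_all add: assms(5) \<D>\<close>)
  then have linear_I: "graded_betti I 0 d \<noteq> 0" unfolding nonzero_I .
  have "{ereal (real j - real i) | i j. graded_betti ?J i j \<noteq> 0}
      = {ereal (real j - real i) | i j. graded_betti I i j \<noteq> 0}" (is "?XJ = ?XI")
  proof (intro equalityI subsetI)
    fix z assume "z \<in> ?XJ"
    then obtain i j where z: "z = ereal (real j - real i)" and "graded_betti ?J i j \<noteq> 0" by blast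
    then consider "graded_betti I i j \<noteq> 0" | "j = i + d" unfolding nonzero_J by blast
    then show "z \<in> ?XI"
    proof cases
      case 2
      then have "z = ereal (real d - real 0)" by (simp add: z)
      with linear_I show ?thesis by blast
    qed (use z in blast)
  next
    fix z assume "z \<in> ?XI"
    then show "z \<in> ?XJ" using nonzero_J by blast
  qed
  then show ?thesis by (simp only: cm_regularity_def)
qed

end
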